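(* Let $\mathcal{A}$ be an abelian length category (as in the context), let $(G,\le)$ be a totally ordered set, and let $M_\bullet=(M_k)_{k\in G}$ be an object of $\mathrm{Gr}_G(\mathcal{A})$ with $M_k\neq 0$ for all $k\in G$ such that $\mathrm{Hom}_{\mathcal{A}}(M_j,M_i)=0$ if $j>i$. Then the following statements hold: 1. $M_\bullet$ T-induces the nested family $\Gamma=\{(\mathsf{T}(\{M_j\mid j\ge k\}),\ (\{M_j\mid j\ge k\})^{\bot})\}_{k\in G}$; that is, $\Gamma$ is a nested family of torsion pairs in $\mathcal{A}$. 2. $M_\bullet$ F-induces the nested family $\Gamma'=\{({}^{\bot}(\{M_j\mid j\le k\}),\ \mathsf{F}(\{M_j\mid j\le k\}))\}_{k\in G}$; that is, $\Gamma'$ is a nested family of torsion pairs in $\mathcal{A}$. 3. $\Gamma$ and $\Gamma'$ are distinct nested families of torsion pairs (as families indexed by $G$). 4. The object $M_\bullet$ lies in the intersection $\mathcal{M}^{*}(\Gamma)\cap\mathcal{N}^{*}(\Gamma')$.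
   Context: Throughout, $\mathcal{A}$ is a $k$-linear, Hom-finite, skeletally small abelian category over an algebraically closed field $k$, in which every object has finite length. For a class $\mathcal{C}$ of objects, $\mathcal{C}^{\bot}=\{M\mid \mathrm{Hom}_{\mathcal{A}}(C,M)=0\ \forall C\in\mathcal{C}\}$ and ${}^{\bot}\mathcal{C}=\{M\mid \mathrm{Hom}_{\mathcal{A}}(M,C)=0\ \forall C\in\mathcal{C}\}$. A torsion pair $(\mathcal{T},\mathcal{F})$ is a pair of full subcategories with $\mathrm{Hom}_{\mathcal{A}}(T,F)=0$ for all $T\in\mathcal{T},F\in\mathcal{F}$, such that each object $M$ admits a short exact sequence $0\to t(M)\to M\to f(M)\to 0$ with $t(M)\in\mathcal{T}$, $f(M)\in\mathcal{F}$. The smallest torsion class containing $\mathcal{C}$ is $\mathsf{T}(\mathcal{C})={}^{\bot}(\mathcal{C}^{\bot})$, the smallest torsion-free class containing $\mathcal{C}$ is $\mathsf{F}(\mathcal{C})=({}^{\bot}\mathcal{C})^{\bot}$; $(\mathsf{T}(\mathcal{C}),\mathcal{C}^{\bot})$ and $({}^{\bot}\mathcal{C},\mathsf{F}(\mathcal{C}))$ are torsion pairs. A nested family of torsion pairs indexed by $G$ is a family $\{(\mathcal{T}_k,\mathcal{F}_k)\}_{k\in G}$ of torsion pairs with $\mathcal{T}_k\supsetneq\mathcal{T}_l$ whenever $k<l$ (equivalently $\mathcal{F}_k\subsetneq\mathcal{F}_l$ whenever $k<l$). $\mathrm{Gr}_G(\mathcal{A})$ is the category of families $(M_k)_{k\in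 G}$ of objects of $\mathcal{A}$, with componentwise morphisms; $0_\bullet=(0)_{k\in G}$. For a nested family $\Gamma=\{(\mathcal{T}_k,\mathcal{F}_k)\}_{k\in G}$: - $\mathcal{M}(\Gamma)$ is the full subcategory of $\mathrm{Gr}_G(\mathcal{A})$ consisting of $0_\bullet$ and the $(M_k)_{k\in G}$ such that for all $k$: $M_k\ne0$, $M_k\in\mathcal{T}_k$, and $M_k\notin\mathcal{T}_j$ whenever $j>k$. $\mathcal{M}^*(\Gamma)$ is its full subcategory consisting of $0_\bullet$ and those $(M_k)\in\mathcal{M}(\Gamma)$ with $M_k\in\mathcal{F}_j$ whenever $j>k$, for all $k$. - $\mathcal{N}(\Gamma)$ is the full subcategory of $\mathrm{Gr}_G(\mathcal{A})$ consisting of $0_\bullet$ and the $(N_k)_{k\in G}$ such that for all $k$: $N_k\neq0$, $N_k\in\mathcal{F}_k$, and $N_k\notin\mathcal{F}_j$ whenever $j<k$. $\mathcal{N}^*(\Gamma)$ is its full subcategory consisting of $0_\bullet$ and those $(N_k)\in\mathcal{N}(\Gamma)$ with $N_k\in\mathcal{T}_j$ whenever $j<k$, for all $k$. $M_\bullet$ T-induces (resp. F-induces) a nested family if that nested family equals the family $\Gamma$ (resp. $\Gamma'$) displayed in the claim. *)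

theory Defs
  imports "HOL-Algebra.Module" "HOL-Algebra.Algebraic_Closure"
begin

section \<open>Linear categories\<close>

text \<open>
  Every hom-set is the carrier of a module record of HOL-Algebra; the ring multiplication and unit
  contained in such a record are never used.  Hom-sets of different pairs of objects are not
  required to be disjoint (a category with disjoint hom-sets is a special case).
  Objects form a set over a type, so skeletal smallness holds automatically.
\<close>

record ('k, 'o, 'm) lincat =
  Ob :: "'o set"
  Mor :: "'o \<Rightarrow> 'o \<Rightarrow> ('k, 'm) module"
  ident :: "'o \<Rightarrow> 'm"
  cmp :: "'m \<Rightarrow> 'm \<Rightarrow> 'm"  (infixl \<open>\<bullet>\<index>\<close> 70)

definition Hom :: "('k, 'o, 'm) lincat \<Rightarrow> 'o \<Rightarrow> 'o \<Rightarrow> 'm set" where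
  "Hom A U V = carrier (Mor A U V)"

definition zero_mor :: "('k, 'o, 'm) lincat \<Rightarrow> 'o \<Rightarrow> 'o \<Rightarrow> 'm" where
  "zero_mor A U V = \<zero>\<^bsub>Mor A U V\<^esub>"

text \<open>Composition is written in the usual order: \<open>g \<bullet> f\<close> is \<open>f\<close> followed by \<open>g\<close>.\<close>

locale linear_category = K?: field K for K :: "'k ring" (structure) and A :: "('k, 'o, 'm) lincat" +
  assumes hom_module: "\<lbrakk>U \<in> Ob A; V \<in> Ob A\<rbrakk> \<Longrightarrow> module K (Mor A U V)"
    and ident_closed: "U \<in> Ob A \<Longrightarrow> ident A U \<in> Hom A U U"
    and cmp_closed:
      "\<lbrakk>U \<in> Ob A; V \<in> Ob A; W \<in> Ob A; f \<in> Hom A U V; g \<in> Hom A V W\<rbrakk> \<Longrightarrow> g \<bullet>\<^bsub>A\<^esub> f \<in> Hom A U W"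
    and ident_left: "\<lbrakk>U \<in> Ob A; V \<in> Ob A; f \<in> Hom A U V\<rbrakk> \<Longrightarrow> ident A V \<bullet>\<^bsub>A\<^esub> f = f"
    and ident_right: "\<lbrakk>U \<in> Ob A; V \<in> Ob A; f \<in> Hom A U V\<rbrakk> \<Longrightarrow> f \<bullet>\<^bsub>A\<^esub> ident A U = f"
    and cmp_assoc:
      "\<lbrakk>T \<in> Ob A; U \<in> Ob A; V \<in> Ob A; W \<in> Ob A; f \<in> Hom A T U; g \<in> Hom A U V; h \<in> Hom A V W\<rbrakk>
        \<Longrightarrow> (h \<bullet>\<^bsub>A\<^esub> g) \<bullet>\<^bsub>A\<^esub> f = h \<bullet>\<^bsub>A\<^esub> (g \<bullet>\<^bsub>A\<^esub> f)"
    and cmp_add_left: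
      "\<lbrakk>U \<in> Ob A; V \<in> Ob A; W \<in> Ob A; f \<in> Hom A U V; g \<in> Hom A V W; h \<in> Hom A V W\<rbrakk>
        \<Longrightarrow> (g \<oplus>\<^bsub>Mor A V W\<^esub> h) \<bullet>\<^bsub>A\<^esub> f = (g \<bullet>\<^bsub>A\<^esub> f) \<oplus>\<^bsub>Mor A U W\<^esub> (h \<bullet>\<^bsub>A\<^esub> f)"
    and cmp_add_right:
      "\<lbrakk>U \<in> Ob A; V \<in> Ob A; W \<in> Ob A; f \<in> Hom A U V; g \<in> Hom A U V; h \<in> Hom A V W\<rbrakk>
        \<Longrightarrow> h \<bullet>\<^bsub>A\<^esub> (f \<oplus>\<^bsub>Mor A U V\<^esub> g) = (h \<bullet>\<^bsub>A\<^esub> f) \<oplus>\<^bsub>Mor A U W\<^esub> (h \<bullet>\<^bsub>A\<^esub> g)"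
    and cmp_smult_left:
      "\<lbrakk>U \<in> Ob A; V \<in> Ob A; W \<in> Ob A; c \<in> carrier K; f \<in> Hom A U V; g \<in> Hom A V W\<rbrakk>
        \<Longrightarrow> (c \<odot>\<^bsub>Mor A V W\<^esub> g) \<bullet>\<^bsub>A\<^esub> f = c \<odot>\<^bsub>Mor A U W\<^esub> (g \<bullet>\<^bsub>A\<^esub> f)"
    and cmp_smult_right:
      "\<lbrakk>U \<in> Ob A; V \<in> Ob A; W \<in> Ob A; c \<in> carrier K; f \<in> Hom A U V; g \<in> Hom A V W\<rbrakk>
        \<Longrightarrow> g \<bullet>\<^bsub>A\<^esub> (c \<odot>\<^bsub>Mor A U V\<^esub> f) = c \<odot>\<^bsub>Mor A U W\<^esub> (g \<bullet>\<^bsub>A\<^esub> f)"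


section \<open>Abelian categories\<close>

definition zero_obj :: "('k, 'o, 'm) lincat \<Rightarrow> 'o \<Rightarrow> bool" where
  "zero_obj A Z \<longleftrightarrow> Z \<in> Ob A \<and>
     (\<forall>U\<in>Ob A. (\<exists>!f. f \<in> Hom A U Z) \<and> (\<exists>!f. f \<in> Hom A Z U))"

definition monic :: "('k, 'o, 'm) lincat \<Rightarrow> 'o \<Rightarrow> 'o \<Rightarrow> 'm \<Rightarrow> bool" where
  "monic A U V f \<longleftrightarrow> f \<in> Hom A U V \<and>
     (\<forall>T\<in>Ob A. \<forall>g\<in>Hom A T U. \<forall>h\<in>Hom A T U. f \<bullet>\<^bsub>A\<^esub> g = f \<bullet>\<^bsub>A\<^esub> h \<longrightarrow> g = h)"

definition epic :: "('k, 'o, 'm) lincat \<Rightarrow> 'o \<Rightarrow> 'o \<Rightarrow> 'm \<Rightarrow> bool" where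
  "epic A U V f \<longleftrightarrow> f \<in> Hom A U V \<and>
     (\<forall>W\<in>Ob A. \<forall>g\<in>Hom A V W. \<forall>h\<in>Hom A V W. g \<bullet>\<^bsub>A\<^esub> f = h \<bullet>\<^bsub>A\<^esub> f \<longrightarrow> g = h)"

definition isomorphism :: "('k, 'o, 'm) lincat \<Rightarrow> 'o \<Rightarrow> 'o \<Rightarrow> 'm \<Rightarrow> bool" where
  "isomorphism A U V f \<longleftrightarrow> f \<in> Hom A U V \<and>
     (\<exists>g\<in>Hom A V U. g \<bullet>\<^bsub>A\<^esub> f = ident A U \<and> f \<bullet>\<^bsub>A\<^esub> g = ident A V)"

text \<open>\<open>is_kernel A U V f N i\<close>: the morphism \<open>i : N \<rightarrow> U\<close> is a kernel of \<open>f : U \<rightarrow> V\<close>.\<close>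

definition is_kernel :: "('k, 'o, 'm) lincat \<Rightarrow> 'o \<Rightarrow> 'o \<Rightarrow> 'm \<Rightarrow> 'o \<Rightarrow> 'm \<Rightarrow> bool" where
  "is_kernel A U V f N i \<longleftrightarrow>
     N \<in> Ob A \<and> i \<in> Hom A N U \<and> f \<bullet>\<^bsub>A\<^esub> i = zero_mor A N V \<and>
     (\<forall>T\<in>Ob A. \<forall>g\<in>Hom A T U. f \<bullet>\<^bsub>A\<^esub> g = zero_mor A T V \<longrightarrow>
        (\<exists>!h. h \<in> Hom A T N \<and> i \<bullet>\<^bsub>A\<^esub> h = g))"

text \<open>\<open>is_cokernel A U V f Q p\<close>: the morphism \<open>p : V \<rightarrow> Q\<close> is a cokernel of \<open>f : U \<rightarrow> V\<close>.\<close>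

definition is_cokernel :: "('k, 'o, 'm) lincat \<Rightarrow> 'o \<Rightarrow> 'o \<Rightarrow> 'm \<Rightarrow> 'o \<Rightarrow> 'm \<Rightarrow> bool" where
  "is_cokernel A U V f Q p \<longleftrightarrow>
     Q \<in> Ob A \<and> p \<in> Hom A V Q \<and> p \<bullet>\<^bsub>A\<^esub> f = zero_mor A U Q \<and>
     (\<forall>T\<in>Ob A. \<forall>g\<in>Hom A V T. g \<bullet>\<^bsub>A\<^esub> f = zero_mor A U T \<longrightarrow>
        (\<exists>!h. h \<in> Hom A Q T \<and> h \<bullet>\<^bsub>A\<^esub> p = g))"

definition is_biproduct ::
    "('k, 'o, 'm) lincat \<Rightarrow> 'o \<Rightarrow> 'o \<Rightarrow> 'o \<Rightarrow> 'm \<Rightarrow> 'm \<Rightarrow> 'm \<Rightarrow> 'm \<Rightarrow> bool" where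
  "is_biproduct A U V P i j p q \<longleftrightarrow>
     P \<in> Ob A \<and> i \<in> Hom A U P \<and> j \<in> Hom A V P \<and> p \<in> Hom A P U \<and> q \<in> Hom A P V \<and>
     p \<bullet>\<^bsub>A\<^esub> i = ident A U \<and> q \<bullet>\<^bsub>A\<^esub> j = ident A V \<and>
     (i \<bullet>\<^bsub>A\<^esub> p) \<oplus>\<^bsub>Mor A P P\<^esub> (j \<bullet>\<^bsub>A\<^esub> q) = ident A P"

locale abelian_category = linear_category K A
  for K :: "'k ring" (structure) and A :: "('k, 'o, 'm) lincat" +
  assumes ex_zero: "\<exists>Z. zero_obj A Z"
    and ex_biproduct: "\<lbrakk>U \<in> Ob A; V \<in> Ob A\<rbrakk> \<Longrightarrow> \<exists>P i j p q. is_biproduct A U V P i j p q"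
    and ex_kernel: "\<lbrakk>U \<in> Ob A; V \<in> Ob A; f \<in> Hom A U V\<rbrakk> \<Longrightarrow> \<exists>N i. is_kernel A U V f N i"
    and ex_cokernel: "\<lbrakk>U \<in> Ob A; V \<in> Ob A; f \<in> Hom A U V\<rbrakk> \<Longrightarrow> \<exists>Q p. is_cokernel A U V f Q p"
    and monic_normal: "\<lbrakk>U \<in> Ob A; V \<in> Ob A; monic A U V f\<rbrakk>
        \<Longrightarrow> \<exists>W\<in>Ob A. \<exists>g\<in>Hom A V W. is_kernel A V W g U f"
    and epic_normal: "\<lbrakk>U \<in> Ob A; V \<in> Ob A; epic A U V f\<rbrakk>
        \<Longrightarrow> \<exists>T\<in>Ob A. \<exists>g\<in>Hom A T U. is_cokernel A T U g V f"

text \<open>\<open>0 \<rightarrow> U \<rightarrow> V \<rightarrow> W \<rightarrow> 0\<close> with maps \<open>f\<close> and \<open>g\<close>.\<close>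

definition short_exact :: "('k, 'o, 'm) lincat \<Rightarrow> 'o \<Rightarrow> 'o \<Rightarrow> 'o \<Rightarrow> 'm \<Rightarrow> 'm \<Rightarrow> bool" where
  "short_exact A U V W f g \<longleftrightarrow> is_kernel A V W g U f \<and> is_cokernel A U V f W g"

definition simple_obj :: "('k, 'o, 'm) lincat \<Rightarrow> 'o \<Rightarrow> bool" where
  "simple_obj A S \<longleftrightarrow> S \<in> Ob A \<and> \<not> zero_obj A S \<and>
     (\<forall>U\<in>Ob A. \<forall>f. monic A U S f \<longrightarrow> zero_obj A U \<or> isomorphism A U S f)"

text \<open>
  A composition series \<open>0 = U 0 \<subseteq> U 1 \<subseteq> \<dots> \<subseteq> U n = M\<close>, with inclusions \<open>i j : U j \<rightarrow> U (j + 1)\<close>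
  whose cokernels \<open>p j : U (j + 1) \<rightarrow> S j\<close> have simple targets.
\<close>

definition finite_length :: "('k, 'o, 'm) lincat \<Rightarrow> 'o \<Rightarrow> bool" where
  "finite_length A M \<longleftrightarrow>
     (\<exists>(n :: nat) U S i p. (\<forall>j\<le>n. U j \<in> Ob A) \<and> zero_obj A (U 0) \<and> U n = M \<and>
        (\<forall>j<n. simple_obj A (S j) \<and> short_exact A (U j) (U (Suc j)) (S j) (i j) (p j)))"

definition fin_dim :: "'k ring \<Rightarrow> ('k, 'm) module \<Rightarrow> bool" where
  "fin_dim K V \<longleftrightarrow> (\<exists>B. finite B \<and> B \<subseteq> carrier V \<and>
     (\<forall>v\<in>carrier V. \<exists>c\<in>B \<rightarrow> carrier K. v = (\<Oplus>\<^bsub>V\<^esub>b\<in>B. c b \<odot>\<^bsub>V\<^esub> b)))"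

locale abelian_length_category = abelian_category K A + algebraically_closed K
  for K :: "'k ring" (structure) and A :: "('k, 'o, 'm) lincat" +
  assumes hom_finite: "\<lbrakk>U \<in> Ob A; V \<in> Ob A\<rbrakk> \<Longrightarrow> fin_dim K (Mor A U V)"
    and all_finite_length: "M \<in> Ob A \<Longrightarrow> finite_length A M"


section \<open>Torsion pairs\<close>

text \<open>Full subcategories are represented by their sets of objects.\<close>

definition rperp :: "('k, 'o, 'm) lincat \<Rightarrow> 'o set \<Rightarrow> 'o set" where
  "rperp A C = {M \<in> Ob A. \<forall>U\<in>C. Hom A U M = {zero_mor A U M}}"

definition lperp :: "('k, 'o, 'm) lincat \<Rightarrow> 'o set \<Rightarrow> 'o set" where
  "lperp A C = {M \<in> Ob A. \<forall>U\<in>C. Hom A M U = {zero_mor A M U}}"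

definition gen_tors :: "('k, 'o, 'm) lincat \<Rightarrow> 'o set \<Rightarrow> 'o set" where
  "gen_tors A C = lperp A (rperp A C)"

definition gen_torsfree :: "('k, 'o, 'm) lincat \<Rightarrow> 'o set \<Rightarrow> 'o set" where
  "gen_torsfree A C = rperp A (lperp A C)"

definition torsion_pair :: "('k, 'o, 'm) lincat \<Rightarrow> 'o set \<times> 'o set \<Rightarrow> bool" where
  "torsion_pair A TF \<longleftrightarrow>
     fst TF \<subseteq> Ob A \<and> snd TF \<subseteq> Ob A \<and>
     (\<forall>T\<in>fst TF. \<forall>F\<in>snd TF. Hom A T F = {zero_mor A T F}) \<and>
     (\<forall>M\<in>Ob A. \<exists>T\<in>fst TF. \<exists>F\<in>snd TF. \<exists>f g. short_exact A T M F f g)"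

text \<open>The index set \<open>G\<close> is a linearly ordered type, hence arbitrary but nonempty.\<close>

definition nested_family :: "('k, 'o, 'm) lincat \<Rightarrow> ('g::linorder \<Rightarrow> 'o set \<times> 'o set) \<Rightarrow> bool" where
  "nested_family A \<Gamma> \<longleftrightarrow>
     (\<forall>k. torsion_pair A (\<Gamma> k)) \<and> (\<forall>k l. k < l \<longrightarrow> fst (\<Gamma> l) \<subset> fst (\<Gamma> k))"


section \<open>Graded objects\<close>

definition Gr :: "('k, 'o, 'm) lincat \<Rightarrow> ('k, 'g \<Rightarrow> 'o, 'g \<Rightarrow> 'm) lincat" where
  "Gr A = \<lparr>
     Ob = {M. \<forall>k. M k \<in> Ob A},
     Mor = (\<lambda>M N. \<lparr>
       carrier = {f. \<forall>k. f k \<in> Hom A (M k) (N k)},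
       monoid.mult = (\<lambda>f g k. f k \<otimes>\<^bsub>Mor A (M k) (N k)\<^esub> g k),
       one = (\<lambda>k. \<one>\<^bsub>Mor A (M k) (N k)\<^esub>),
       zero = (\<lambda>k. zero_mor A (M k) (N k)),
       add = (\<lambda>f g k. f k \<oplus>\<^bsub>Mor A (M k) (N k)\<^esub> g k),
       smult = (\<lambda>c f k. c \<odot>\<^bsub>Mor A (M k) (N k)\<^esub> f k) \<rparr>),
     ident = (\<lambda>M k. ident A (M k)),
     cmp = (\<lambda>g f k. g k \<bullet>\<^bsub>A\<^esub> f k) \<rparr>"

text \<open>The object \<open>0\<^sub>\<bullet>\<close>, up to the choice of the zero object of \<open>A\<close> in each degree.\<close>

definition zero_family :: "('k, 'o, 'm) lincat \<Rightarrow> ('g \<Rightarrow> 'o) \<Rightarrow> bool" where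
  "zero_family A M \<longleftrightarrow> (\<forall>k. zero_obj A (M k))"

definition MM :: "('k, 'o, 'm) lincat \<Rightarrow> ('g::linorder \<Rightarrow> 'o set \<times> 'o set) \<Rightarrow> ('g \<Rightarrow> 'o) set" where
  "MM A \<Gamma> = {M \<in> Ob (Gr A). zero_family A M \<or>
     (\<forall>k. \<not> zero_obj A (M k) \<and> M k \<in> fst (\<Gamma> k) \<and> (\<forall>j>k. M k \<notin> fst (\<Gamma> j)))}"

definition MM_star :: "('k, 'o, 'm) lincat \<Rightarrow> ('g::linorder \<Rightarrow> 'o set \<times> 'o set) \<Rightarrow> ('g \<Rightarrow> 'o) set" where
  "MM_star A \<Gamma> = {M \<in> MM A \<Gamma>. zero_family A M \<or> (\<forall>k. \<forall>j>k. M k \<in> snd (\<Gamma> j))}"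

definition NN :: "('k, 'o, 'm) lincat \<Rightarrow> ('g::linorder \<Rightarrow> 'o set \<times> 'o set) \<Rightarrow> ('g \<Rightarrow> 'o) set" where
  "NN A \<Gamma> = {N \<in> Ob (Gr A). zero_family A N \<or>
     (\<forall>k. \<not> zero_obj A (N k) \<and> N k \<in> snd (\<Gamma> k) \<and> (\<forall>j<k. N k \<notin> snd (\<Gamma> j)))}"

definition NN_star :: "('k, 'o, 'm) lincat \<Rightarrow> ('g::linorder \<Rightarrow> 'o set \<times> 'o set) \<Rightarrow> ('g \<Rightarrow> 'o) set" where
  "NN_star A \<Gamma> = {N \<in> NN A \<Gamma>. zero_family A N \<or> (\<forall>k. \<forall>j<k. N k \<in> fst (\<Gamma> j))}"

definition T_induces ::
    "('k, 'o, 'm) lincat \<Rightarrow> ('g::linorder \<Rightarrow> 'o) \<Rightarrow> ('g \<Rightarrow> 'o set \<times> 'o set) \<Rightarrow> bool" where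
  "T_induces A M \<Gamma> \<longleftrightarrow> nested_family A \<Gamma> \<and>
     \<Gamma> = (\<lambda>k. (gen_tors A {M j |j. j \<ge> k}, rperp A {M j |j. j \<ge> k}))"

definition F_induces ::
    "('k, 'o, 'm) lincat \<Rightarrow> ('g::linorder \<Rightarrow> 'o) \<Rightarrow> ('g \<Rightarrow> 'o set \<times> 'o set) \<Rightarrow> bool" where
  "F_induces A M \<Gamma> \<longleftrightarrow> nested_family A \<Gamma> \<and>
     \<Gamma> = (\<lambda>k. (lperp A {M j |j. j \<le> k}, gen_torsfree A {M j |j. j \<le> k}))"

end

theory Submission
  imports Defs
begin

text \<open>
  For every class \<open>C\<close> of objects, \<open>(gen_tors A C, rperp A C)\<close> is a torsion pair: if \<open>M\<close> is not in
  \<open>rperp A C\<close>, pass to the cokernel \<open>M1\<close> of a nonzero map \<open>U \<rightarrow> M\<close> with \<open>U\<close> in \<open>C\<close>. It is shorter than \<open>M\<close>,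
  and the kernel of \<open>M \<rightarrow> M1 \<rightarrow> F\<close>, with \<open>F\<close> the torsion-free quotient of \<open>M1\<close>, is an extension of the
  torsion part of \<open>M1\<close> by the image of \<open>U\<close>, hence torsion. The pairs of \<open>\<Gamma>'\<close> need no dual argument,
  being of the same form for the class \<open>lperp A C\<close>. Strictness of the inclusions and
  \<open>\<Gamma> \<noteq> \<Gamma>'\<close> are all witnessed by the objects \<open>M k\<close>, because the identity of \<open>M k\<close> is nonzero.
\<close>

section \<open>Arrows in linear categories\<close>

lemma ex1_unique: "\<lbrakk>\<exists>!x. P x; P x; P y\<rbrakk> \<Longrightarrow> x = y"
  by blast

context linear_category
begin

text \<open>Hom-sets of different pairs of objects may overlap, so source and target are always carried along.\<close>

definition arr :: "'m \<Rightarrow> 'o \<Rightarrow> 'o \<Rightarrow> bool" where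
  "arr f U V \<longleftrightarrow> U \<in> Ob A \<and> V \<in> Ob A \<and> f \<in> Hom A U V"

lemma arrI: "\<lbrakk>U \<in> Ob A; V \<in> Ob A; f \<in> Hom A U V\<rbrakk> \<Longrightarrow> arr f U V"
  by (simp add: arr_def)

lemma arrD: "arr f U V \<Longrightarrow> U \<in> Ob A" "arr f U V \<Longrightarrow> V \<in> Ob A" "arr f U V \<Longrightarrow> f \<in> Hom A U V"
  by (simp_all add: arr_def)

lemma arr_cmp: "\<lbrakk>arr g V W; arr f U V\<rbrakk> \<Longrightarrow> arr (g \<bullet>\<^bsub>A\<^esub> f) U W"
  by (auto simp: arr_def intro: cmp_closed)

lemma arr_ident: "U \<in> Ob A \<Longrightarrow> arr (ident A U) U U"
  by (simp add: arr_def ident_closed)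

lemma arr_zero: "\<lbrakk>U \<in> Ob A; V \<in> Ob A\<rbrakk> \<Longrightarrow> arr (zero_mor A U V) U V"
  using module.axioms(2)[OF hom_module]
  by (simp add: arr_def Hom_def zero_mor_def abelian_group_def abelian_monoid.zero_closed)

lemma assoc:
  "\<lbrakk>arr h V W; arr g U V; arr f T U\<rbrakk> \<Longrightarrow> (h \<bullet>\<^bsub>A\<^esub> g) \<bullet>\<^bsub>A\<^esub> f = h \<bullet>\<^bsub>A\<^esub> (g \<bullet>\<^bsub>A\<^esub> f)"
  by (auto simp: arr_def intro: cmp_assoc)

lemma id_left: "arr f U V \<Longrightarrow> ident A V \<bullet>\<^bsub>A\<^esub> f = f"
  by (auto simp: arr_def intro: ident_left)

lemma id_right: "arr f U V \<Longrightarrow> f \<bullet>\<^bsub>A\<^esub> ident A U = f"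
  by (auto simp: arr_def intro: ident_right)

section \<open>Zero morphisms and cancellation\<close>

lemma abelian_group_Mor: "\<lbrakk>U \<in> Ob A; V \<in> Ob A\<rbrakk> \<Longrightarrow> abelian_group (Mor A U V)"
  using module.axioms(2)[OF hom_module] .

text \<open>Additivity gives \<open>f 0 = f 0 + f 0\<close>, and cancellation in the group of
  morphisms leaves zero.\<close>

lemma cmp_zero_right:
  assumes f: "arr f V W" and U: "U \<in> Ob A"
  shows "f \<bullet>\<^bsub>A\<^esub> zero_mor A U V = zero_mor A U W"
proof -
  note V = arrD(1)[OF f] and W = arrD(2)[OF f]
  interpret UV: abelian_group "Mor A U V" by (rule abelian_group_Mor[OF U V])
  interpret UW: abelian_group "Mor A U W" by (rule abelian_group_Mor[OF U W])
  let ?z = "zero_mor A U V"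
  have z: "?z \<in> Hom A U V" using arr_zero[OF U V] by (simp add: arr_def)
  have c: "f \<bullet>\<^bsub>A\<^esub> ?z \<in> carrier (Mor A U W)"
    using arr_cmp[OF f arr_zero[OF U V]] by (simp add: arr_def Hom_def)
  have "?z \<oplus>\<^bsub>Mor A U V\<^esub> ?z = ?z" by (simp add: zero_mor_def)
  then have "f \<bullet>\<^bsub>A\<^esub> ?z = (f \<bullet>\<^bsub>A\<^esub> ?z) \<oplus>\<^bsub>Mor A U W\<^esub> (f \<bullet>\<^bsub>A\<^esub> ?z)"
    using cmp_add_right[OF U V W z z arrD(3)[OF f]] by simp
  then show ?thesis
    unfolding zero_mor_def using c by (metis UW.add.l_cancel_one zero_mor_def)
qed

lemma cmp_zero_left:
  assumes f: "arr f U V" and W: "W \<in> Ob A"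
  shows "zero_mor A V W \<bullet>\<^bsub>A\<^esub> f = zero_mor A U W"
proof -
  note U = arrD(1)[OF f] and V = arrD(2)[OF f]
  interpret VW: abelian_group "Mor A V W" by (rule abelian_group_Mor[OF V W])
  interpret UW: abelian_group "Mor A U W" by (rule abelian_group_Mor[OF U W])
  let ?z = "zero_mor A V W"
  have z: "?z \<in> Hom A V W" using arr_zero[OF V W] by (simp add: arr_def)
  have c: "?z \<bullet>\<^bsub>A\<^esub> f \<in> carrier (Mor A U W)"
    using arr_cmp[OF arr_zero[OF V W] f] by (simp add: arr_def Hom_def)
  have "?z \<oplus>\<^bsub>Mor A V W\<^esub> ?z = ?z" by (simp add: zero_mor_def)
  then have "?z \<bullet>\<^bsub>A\<^esub> f = (?z \<bullet>\<^bsub>A\<^esub> f) \<oplus>\<^bsub>Mor A U W\<^esub> (?z \<bullet>\<^bsub>A\<^esub> f)"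
    using cmp_add_left[OF U V W arrD(3)[OF f] z z] by simp
  then show ?thesis
    unfolding zero_mor_def using c by (metis UW.add.l_cancel_one zero_mor_def)
qed

text \<open>Two maps with the same composite with \<open>f\<close> differ by a map that
  \<open>f\<close> kills, so cancellation reduces to cancellation against zero.\<close>

lemma monicI:
  assumes f: "arr f U V"
    and 0: "\<And>T g. \<lbrakk>arr g T U; f \<bullet>\<^bsub>A\<^esub> g = zero_mor A T V\<rbrakk> \<Longrightarrow> g = zero_mor A T U"
  shows "monic A U V f"
  unfolding monic_def
proof (intro conjI ballI impI)
  show "f \<in> Hom A U V" using f by (rule arrD)
next
  fix T g h assume T: "T \<in> Ob A" and g: "g \<in> Hom A T U" and h: "h \<in> Hom A T U"
    and eq: "f \<bullet>\<^bsub>A\<^esub> g = f \<bullet>\<^bsub>A\<^esub> h"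
  note U = arrD(1)[OF f] and V = arrD(2)[OF f]
  interpret TU: abelian_group "Mor A T U" by (rule abelian_group_Mor[OF T U])
  interpret TV: abelian_group "Mor A T V" by (rule abelian_group_Mor[OF T V])
  define d where "d = g \<ominus>\<^bsub>Mor A T U\<^esub> h"
  have gc: "g \<in> carrier (Mor A T U)" and hc: "h \<in> carrier (Mor A T U)"
    using g h by (simp_all add: Hom_def)
  have dc: "d \<in> carrier (Mor A T U)" using gc hc by (simp add: d_def)
  then have d: "arr d T U" using T U by (simp add: arr_def Hom_def)
  have dh: "d \<oplus>\<^bsub>Mor A T U\<^esub> h = g"
    using gc hc by (simp add: d_def TU.minus_eq TU.a_assoc TU.l_neg)
  have "(f \<bullet>\<^bsub>A\<^esub> d) \<oplus>\<^bsub>Mor A T V\<^esub> (f \<bullet>\<^bsub>A\<^esub> h) = f \<bullet>\<^bsub>A\<^esub> h"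
    using cmp_add_right[OF T U V arrD(3)[OF d] h arrD(3)[OF f]] dh eq by simp
  moreover have "f \<bullet>\<^bsub>A\<^esub> d \<in> carrier (Mor A T V)" "f \<bullet>\<^bsub>A\<^esub> h \<in> carrier (Mor A T V)"
    using arr_cmp[OF f d] cmp_closed[OF T U V h arrD(3)[OF f]] by (simp_all add: arr_def Hom_def)
  ultimately have "f \<bullet>\<^bsub>A\<^esub> d = zero_mor A T V"
    unfolding zero_mor_def by simp
  then have "d = zero_mor A T U" by (rule 0[OF d])
  then show "g = h" using dh hc by (simp add: zero_mor_def)
qed

lemma epicI:
  assumes f: "arr f U V"
    and 0: "\<And>W g. \<lbrakk>arr g V W; g \<bullet>\<^bsub>A\<^esub> f = zero_mor A U W\<rbrakk> \<Longrightarrow> g = zero_mor A V W"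
  shows "epic A U V f"
  unfolding epic_def
proof (intro conjI ballI impI)
  show "f \<in> Hom A U V" using f by (rule arrD)
next
  fix W g h assume W: "W \<in> Ob A" and g: "g \<in> Hom A V W" and h: "h \<in> Hom A V W"
    and eq: "g \<bullet>\<^bsub>A\<^esub> f = h \<bullet>\<^bsub>A\<^esub> f"
  note U = arrD(1)[OF f] and V = arrD(2)[OF f]
  interpret VW: abelian_group "Mor A V W" by (rule abelian_group_Mor[OF V W])
  interpret UW: abelian_group "Mor A U W" by (rule abelian_group_Mor[OF U W])
  define d where "d = g \<ominus>\<^bsub>Mor A V W\<^esub> h"
  have gc: "g \<in> carrier (Mor A V W)" and hc: "h \<in> carrier (Mor A V W)"
    using g h by (simp_all add: Hom_def)
  have dc: "d \<in> carrier (Mor A V W)" using gc hc by (simp add: d_def)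
  then have d: "arr d V W" using V W by (simp add: arr_def Hom_def)
  have dh: "d \<oplus>\<^bsub>Mor A V W\<^esub> h = g"
    using gc hc by (simp add: d_def VW.minus_eq VW.a_assoc VW.l_neg)
  have "(d \<bullet>\<^bsub>A\<^esub> f) \<oplus>\<^bsub>Mor A U W\<^esub> (h \<bullet>\<^bsub>A\<^esub> f) = h \<bullet>\<^bsub>A\<^esub> f"
    using cmp_add_left[OF U V W arrD(3)[OF f] arrD(3)[OF d] h] dh eq by simp
  moreover have "d \<bullet>\<^bsub>A\<^esub> f \<in> carrier (Mor A U W)" "h \<bullet>\<^bsub>A\<^esub> f \<in> carrier (Mor A U W)"
    using arr_cmp[OF d f] cmp_closed[OF U V W arrD(3)[OF f] h] by (simp_all add: arr_def Hom_def)
  ultimately have "d \<bullet>\<^bsub>A\<^esub> f = zero_mor A U W"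
    unfolding zero_mor_def by simp
  then have "d = zero_mor A V W" by (rule 0[OF d])
  then show "g = h" using dh hc by (simp add: zero_mor_def)
qed

lemma monic_cancel:
  "\<lbrakk>monic A U V f; arr g T U; arr h T U; f \<bullet>\<^bsub>A\<^esub> g = f \<bullet>\<^bsub>A\<^esub> h\<rbrakk> \<Longrightarrow> g = h"
  by (auto simp: monic_def arr_def)

lemma epic_cancel:
  "\<lbrakk>epic A U V f; arr g V W; arr h V W; g \<bullet>\<^bsub>A\<^esub> f = h \<bullet>\<^bsub>A\<^esub> f\<rbrakk> \<Longrightarrow> g = h"
  by (auto simp: epic_def arr_def)

lemma monic_zero:
  assumes "monic A U V f" "V \<in> Ob A" "arr g T U" "f \<bullet>\<^bsub>A\<^esub> g = zero_mor A T V"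
  shows "g = zero_mor A T U"
proof (rule monic_cancel[OF assms(1,3)])
  have "arr f U V" using assms by (auto simp: monic_def arr_def)
  then show "f \<bullet>\<^bsub>A\<^esub> g = f \<bullet>\<^bsub>A\<^esub> zero_mor A T U"
    using assms cmp_zero_right arrD by simp
  show "arr (zero_mor A T U) T U" using assms arr_zero arrD by simp
qed

lemma epic_zero:
  assumes "epic A U V f" "U \<in> Ob A" "arr g V W" "g \<bullet>\<^bsub>A\<^esub> f = zero_mor A U W"
  shows "g = zero_mor A V W"
proof (rule epic_cancel[OF assms(1,3)])
  have "arr f U V" using assms by (auto simp: epic_def arr_def)
  then show "g \<bullet>\<^bsub>A\<^esub> f = zero_mor A V W \<bullet>\<^bsub>A\<^esub> f"
    using assms cmp_zero_left arrD by simp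
  show "arr (zero_mor A V W) V W" using assms arr_zero arrD by simp
qed

lemma epic_arr: "\<lbrakk>epic A U V f; U \<in> Ob A; V \<in> Ob A\<rbrakk> \<Longrightarrow> arr f U V"
  by (simp add: epic_def arr_def)

lemma monic_arr: "\<lbrakk>monic A U V f; U \<in> Ob A; V \<in> Ob A\<rbrakk> \<Longrightarrow> arr f U V"
  by (simp add: monic_def arr_def)

lemma epic_cmp:
  assumes f: "epic A U V f" and g: "epic A V W g" and ob: "U \<in> Ob A" "V \<in> Ob A" "W \<in> Ob A"
  shows "epic A U W (g \<bullet>\<^bsub>A\<^esub> f)"
proof (rule epicI)
  note af = epic_arr[OF f ob(1,2)] and ag = epic_arr[OF g ob(2,3)]
  show "arr (g \<bullet>\<^bsub>A\<^esub> f) U W" by (rule arr_cmp[OF ag af])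
  fix Y h assume h: "arr h W Y" and z: "h \<bullet>\<^bsub>A\<^esub> (g \<bullet>\<^bsub>A\<^esub> f) = zero_mor A U Y"
  have "(h \<bullet>\<^bsub>A\<^esub> g) \<bullet>\<^bsub>A\<^esub> f = zero_mor A U Y" using z assoc[OF h ag af] by simp
  then have "h \<bullet>\<^bsub>A\<^esub> g = zero_mor A V Y" by (rule epic_zero[OF f ob(1) arr_cmp[OF h ag]])
  then show "h = zero_mor A W Y" by (rule epic_zero[OF g ob(2) h])
qed

lemma epic_right_factor:
  assumes f: "arr f U V" and g: "arr g V W" and e: "epic A U W (g \<bullet>\<^bsub>A\<^esub> f)"
  shows "epic A V W g"
proof (rule epicI[OF g])
  fix Y h assume h: "arr h W Y" and z: "h \<bullet>\<^bsub>A\<^esub> g = zero_mor A V Y"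
  have "h \<bullet>\<^bsub>A\<^esub> (g \<bullet>\<^bsub>A\<^esub> f) = zero_mor A U Y"
    using z assoc[OF h g f] cmp_zero_left[OF f arrD(2)[OF h]] by simp
  then show "h = zero_mor A W Y" by (rule epic_zero[OF e arrD(1)[OF f] h])
qed

lemma split_epic:
  assumes f: "arr f U V" and g: "arr g V U" and i: "f \<bullet>\<^bsub>A\<^esub> g = ident A V"
  shows "epic A U V f"
proof (rule epicI[OF f])
  fix W h assume h: "arr h V W" and z: "h \<bullet>\<^bsub>A\<^esub> f = zero_mor A U W"
  have "h = (h \<bullet>\<^bsub>A\<^esub> f) \<bullet>\<^bsub>A\<^esub> g" using assoc[OF h f g] i id_right[OF h] by simp
  then show "h = zero_mor A V W" using z cmp_zero_left[OF g arrD(2)[OF h]] by simp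
qed

section \<open>Universal properties of kernels and cokernels\<close>

lemma kernel_arr: "\<lbrakk>is_kernel A U V f N i; U \<in> Ob A\<rbrakk> \<Longrightarrow> arr i N U"
  by (simp add: is_kernel_def arr_def)

lemma kernel_cmp: "is_kernel A U V f N i \<Longrightarrow> f \<bullet>\<^bsub>A\<^esub> i = zero_mor A N V"
  by (simp add: is_kernel_def)

lemma kernel_lift:
  assumes "is_kernel A U V f N i" "arr g T U" "f \<bullet>\<^bsub>A\<^esub> g = zero_mor A T V"
  obtains h where "arr h T N" "i \<bullet>\<^bsub>A\<^esub> h = g"
proof -
  have "\<exists>!h. h \<in> Hom A T N \<and> i \<bullet>\<^bsub>A\<^esub> h = g"
    using assms by (simp add: is_kernel_def arr_def)
  then obtain h where "h \<in> Hom A T N" "i \<bullet>\<^bsub>A\<^esub> h = g" by (elim ex1E conjE)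
  moreover have "N \<in> Ob A" using assms(1) by (simp add: is_kernel_def)
  ultimately show thesis using that assms(2) by (simp add: arr_def)
qed

text \<open>Both \<open>g\<close> and the zero map lift the zero map along \<open>i\<close>, so the
  uniqueness clause of the kernel identifies them.\<close>

lemma kernel_monic:
  assumes k: "is_kernel A U V f N i" and f: "arr f U V"
  shows "monic A N U i"
proof (rule monicI)
  show i: "arr i N U" by (rule kernel_arr[OF k arrD(1)[OF f]])
  fix T g assume g: "arr g T N" and z: "i \<bullet>\<^bsub>A\<^esub> g = zero_mor A T U"
  note T = arrD(1)[OF g]
  have z0: "arr (zero_mor A T N) T N" by (rule arr_zero[OF T arrD(1)[OF i]])
  have "\<exists>!h. h \<in> Hom A T N \<and> i \<bullet>\<^bsub>A\<^esub> h = zero_mor A T U"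
    using k T arr_zero[OF T arrD(2)[OF i]] cmp_zero_right[OF f T]
    by (simp add: is_kernel_def arr_def)
  then show "g = zero_mor A T N"
    by (rule ex1_unique) (use z arrD(3)[OF g] arrD(3)[OF z0] cmp_zero_right[OF i T] in simp_all)
qed

lemma cokernel_arr: "\<lbrakk>is_cokernel A U V f Q p; V \<in> Ob A\<rbrakk> \<Longrightarrow> arr p V Q"
  by (simp add: is_cokernel_def arr_def)

lemma cokernel_cmp: "is_cokernel A U V f Q p \<Longrightarrow> p \<bullet>\<^bsub>A\<^esub> f = zero_mor A U Q"
  by (simp add: is_cokernel_def)

lemma cokernel_desc:
  assumes "is_cokernel A U V f Q p" "arr g V T" "g \<bullet>\<^bsub>A\<^esub> f = zero_mor A U T"
  obtains h where "arr h Q T" "h \<bullet>\<^bsub>A\<^esub> p = g"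
proof -
  have "\<exists>!h. h \<in> Hom A Q T \<and> h \<bullet>\<^bsub>A\<^esub> p = g"
    using assms by (simp add: is_cokernel_def arr_def)
  then obtain h where "h \<in> Hom A Q T" "h \<bullet>\<^bsub>A\<^esub> p = g" by (elim ex1E conjE)
  moreover have "Q \<in> Ob A" using assms(1) by (simp add: is_cokernel_def)
  ultimately show thesis using that assms(2) by (simp add: arr_def)
qed

lemma cokernel_epic:
  assumes k: "is_cokernel A U V f Q p" and f: "arr f U V"
  shows "epic A V Q p"
proof (rule epicI)
  show p: "arr p V Q" by (rule cokernel_arr[OF k arrD(2)[OF f]])
  fix T g assume g: "arr g Q T" and z: "g \<bullet>\<^bsub>A\<^esub> p = zero_mor A V T"
  note T = arrD(2)[OF g]
  have z0: "arr (zero_mor A Q T) Q T" by (rule arr_zero[OF arrD(2)[OF p] T])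
  have "\<exists>!h. h \<in> Hom A Q T \<and> h \<bullet>\<^bsub>A\<^esub> p = zero_mor A V T"
    using k T arr_zero[OF arrD(1)[OF p] T] cmp_zero_left[OF f T]
    by (simp add: is_cokernel_def arr_def)
  then show "g = zero_mor A Q T"
    by (rule ex1_unique) (use z arrD(3)[OF g] arrD(3)[OF z0] cmp_zero_left[OF p T] in simp_all)
qed

text \<open>Lifts along a monic \<open>i\<close> are unique, so a kernel can be recognised from the
  existence of lifts.\<close>

lemma is_kernelI:
  assumes i: "monic A N U i" "arr i N U" and z: "f \<bullet>\<^bsub>A\<^esub> i = zero_mor A N V"
    and l: "\<And>T g. \<lbrakk>arr g T U; f \<bullet>\<^bsub>A\<^esub> g = zero_mor A T V\<rbrakk> \<Longrightarrow> \<exists>h. arr h T N \<and> i \<bullet>\<^bsub>A\<^esub> h = g"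
  shows "is_kernel A U V f N i"
  unfolding is_kernel_def
proof (intro conjI ballI impI)
  show "N \<in> Ob A" "i \<in> Hom A N U" using i(2) by (auto dest: arrD)
  show "f \<bullet>\<^bsub>A\<^esub> i = zero_mor A N V" by (rule z)
  fix T g assume T: "T \<in> Ob A" and "g \<in> Hom A T U" "f \<bullet>\<^bsub>A\<^esub> g = zero_mor A T V"
  then obtain h where h: "arr h T N" "i \<bullet>\<^bsub>A\<^esub> h = g" using l i(2) by (metis arr_def)
  have "h' = h" if "h' \<in> Hom A T N \<and> i \<bullet>\<^bsub>A\<^esub> h' = g" for h'
    by (rule monic_cancel[OF i(1) _ h(1)]) (use that h arrD(2)[OF h(1)] T in \<open>auto simp: arr_def\<close>)
  with h show "\<exists>!h. h \<in> Hom A T N \<and> i \<bullet>\<^bsub>A\<^esub> h = g"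
    by (intro ex1I[of _ h]) (auto simp: arr_def)
qed

lemma is_cokernelI:
  assumes p: "epic A V Q p" "arr p V Q" and z: "p \<bullet>\<^bsub>A\<^esub> f = zero_mor A U Q"
    and l: "\<And>T g. \<lbrakk>arr g V T; g \<bullet>\<^bsub>A\<^esub> f = zero_mor A U T\<rbrakk> \<Longrightarrow> \<exists>h. arr h Q T \<and> h \<bullet>\<^bsub>A\<^esub> p = g"
  shows "is_cokernel A U V f Q p"
  unfolding is_cokernel_def
proof (intro conjI ballI impI)
  show "Q \<in> Ob A" "p \<in> Hom A V Q" using p(2) by (auto dest: arrD)
  show "p \<bullet>\<^bsub>A\<^esub> f = zero_mor A U Q" by (rule z)
  fix T g assume T: "T \<in> Ob A" and "g \<in> Hom A V T" "g \<bullet>\<^bsub>A\<^esub> f = zero_mor A U T"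
  then obtain h where h: "arr h Q T" "h \<bullet>\<^bsub>A\<^esub> p = g" using l p(2) by (metis arr_def)
  have "h' = h" if "h' \<in> Hom A Q T \<and> h' \<bullet>\<^bsub>A\<^esub> p = g" for h'
    by (rule epic_cancel[OF p(1) _ h(1)]) (use that h arrD(1)[OF h(1)] T in \<open>auto simp: arr_def\<close>)
  with h show "\<exists>!h. h \<in> Hom A Q T \<and> h \<bullet>\<^bsub>A\<^esub> p = g"
    by (intro ex1I[of _ h]) (auto simp: arr_def)
qed

section \<open>Zero objects\<close>

lemma zero_objD:
  assumes "zero_obj A Z"
  shows "arr f U Z \<Longrightarrow> f = zero_mor A U Z" "arr f Z U \<Longrightarrow> f = zero_mor A Z U"
proof -
  have Z: "Z \<in> Ob A" using assms by (simp add: zero_obj_def)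
  show "f = zero_mor A U Z" if f: "arr f U Z"
  proof -
    have U: "U \<in> Ob A" by (rule arrD(1)[OF f])
    then have "\<exists>!f. f \<in> Hom A U Z" using assms by (simp add: zero_obj_def)
    then show ?thesis using arrD(3)[OF f] arrD(3)[OF arr_zero[OF U Z]] by (rule ex1_unique)
  qed
  show "f = zero_mor A Z U" if f: "arr f Z U"
  proof -
    have U: "U \<in> Ob A" by (rule arrD(2)[OF f])
    then have "\<exists>!f. f \<in> Hom A Z U" using assms by (simp add: zero_obj_def)
    then show ?thesis using arrD(3)[OF f] arrD(3)[OF arr_zero[OF Z U]] by (rule ex1_unique)
  qed
qed

text \<open>Every map into or out of \<open>Z\<close> equals its composite with
  \<open>ident A Z\<close>, hence is zero.\<close>

lemma zero_objI:
  assumes Z: "Z \<in> Ob A" and i: "ident A Z = zero_mor A Z Z"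
  shows "zero_obj A Z"
proof -
  have l: "f = zero_mor A U Z" if "arr f U Z" for f U
    using id_left[OF that] i cmp_zero_left[OF that Z] by simp
  have r: "f = zero_mor A Z U" if "arr f Z U" for f U
    using id_right[OF that] i cmp_zero_right[OF that Z] by simp
  have "\<exists>!f. f \<in> Hom A U Z" if U: "U \<in> Ob A" for U
    using arrD(3)[OF arr_zero[OF U Z]] l[OF arrI[OF U Z]] by (rule ex1I)
  moreover have "\<exists>!f. f \<in> Hom A Z U" if U: "U \<in> Ob A" for U
    using arrD(3)[OF arr_zero[OF Z U]] r[OF arrI[OF Z U]] by (rule ex1I)
  ultimately show ?thesis using Z by (simp add: zero_obj_def)
qed

text \<open>Settles the torsion-free case of the induction on length: zero torsion part, and the
  object itself as quotient.\<close>

lemma short_exact_zero: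
  assumes Z: "zero_obj A Z" and M: "M \<in> Ob A"
  shows "short_exact A Z M M (zero_mor A Z M) (ident A M)"
proof -
  have Zo: "Z \<in> Ob A" using Z by (simp add: zero_obj_def)
  note z = arr_zero[OF Zo M] and i = arr_ident[OF M]
  have "is_kernel A M M (ident A M) Z (zero_mor A Z M)"
  proof (rule is_kernelI[OF _ z])
    show "monic A Z M (zero_mor A Z M)" by (rule monicI[OF z]) (rule zero_objD(1)[OF Z])
    show "ident A M \<bullet>\<^bsub>A\<^esub> zero_mor A Z M = zero_mor A Z M" by (rule id_left[OF z])
    fix T g assume g: "arr g T M" and "ident A M \<bullet>\<^bsub>A\<^esub> g = zero_mor A T M"
    then have "g = zero_mor A T M" using id_left[OF g] by simp
    then show "\<exists>h. arr h T Z \<and> zero_mor A Z M \<bullet>\<^bsub>A\<^esub> h = g"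
      using arr_zero[OF arrD(1)[OF g] Zo] cmp_zero_right[OF z arrD(1)[OF g]] by blast
  qed
  moreover have "is_cokernel A Z M (zero_mor A Z M) M (ident A M)"
  proof (rule is_cokernelI[OF _ i])
    show "epic A M M (ident A M)" by (rule split_epic[OF i i id_left[OF i]])
    show "ident A M \<bullet>\<^bsub>A\<^esub> zero_mor A Z M = zero_mor A Z M" by (rule id_left[OF z])
    show "\<exists>h. arr h M T \<and> h \<bullet>\<^bsub>A\<^esub> ident A M = g" if "arr g M T" for T g
      using that id_right by blast
  qed
  ultimately show ?thesis by (simp add: short_exact_def)
qed

end


section \<open>Abelian categories\<close>

context abelian_category
begin

text \<open>Normality makes \<open>f\<close> the kernel of some \<open>g\<close>. Since
  \<open>g\<close> factors through the cokernel \<open>p\<close>, everything killed by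
  \<open>p\<close> is killed by \<open>g\<close> and so lifts along \<open>f\<close>.\<close>

lemma kernel_of_cokernel:
  assumes m: "monic A U V f" and c: "is_cokernel A U V f Q p" and ob: "U \<in> Ob A" "V \<in> Ob A"
  shows "is_kernel A V Q p U f"
proof -
  note f = monic_arr[OF m ob]
  obtain W g where W: "W \<in> Ob A" "g \<in> Hom A V W" and k: "is_kernel A V W g U f"
    using monic_normal[OF ob m] by blast
  have g: "arr g V W" using W ob by (simp add: arr_def)
  obtain h where h: "arr h Q W" "h \<bullet>\<^bsub>A\<^esub> p = g"
    using cokernel_desc[OF c g kernel_cmp[OF k]] .
  note p = cokernel_arr[OF c ob(2)]
  show ?thesis
  proof (rule is_kernelI[OF m f cokernel_cmp[OF c]])
    fix T x assume x: "arr x T V" and z: "p \<bullet>\<^bsub>A\<^esub> x = zero_mor A T Q"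
    have "g \<bullet>\<^bsub>A\<^esub> x = zero_mor A T W"
      using assoc[OF h(1) p x] h(2) z cmp_zero_right[OF h(1) arrD(1)[OF x]] by simp
    then show "\<exists>y. arr y T U \<and> f \<bullet>\<^bsub>A\<^esub> y = x" using kernel_lift[OF k x] by blast
  qed
qed

text \<open>Dually, \<open>f\<close> is the cokernel of some \<open>g\<close>, and \<open>g\<close>
  factors through the kernel \<open>i\<close>; a map that vanishes on \<open>i\<close> vanishes on
  \<open>g\<close> and so descends along \<open>f\<close>.\<close>

lemma cokernel_of_kernel:
  assumes e: "epic A U V f" and k: "is_kernel A U V f N i" and ob: "U \<in> Ob A" "V \<in> Ob A"
  shows "is_cokernel A N U i V f"
proof -
  note f = epic_arr[OF e ob]
  obtain T g where T: "T \<in> Ob A" "g \<in> Hom A T U" and c: "is_cokernel A T U g V f"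
    using epic_normal[OF ob e] by blast
  have g: "arr g T U" using T ob by (simp add: arr_def)
  obtain h where h: "arr h T N" "i \<bullet>\<^bsub>A\<^esub> h = g"
    using kernel_lift[OF k g cokernel_cmp[OF c]] .
  note i = kernel_arr[OF k ob(1)]
  show ?thesis
  proof (rule is_cokernelI[OF e f kernel_cmp[OF k]])
    fix W x assume x: "arr x U W" and z: "x \<bullet>\<^bsub>A\<^esub> i = zero_mor A N W"
    have "x \<bullet>\<^bsub>A\<^esub> g = zero_mor A T W"
      using assoc[OF x i h(1)] h(2) z cmp_zero_left[OF h(1) arrD(2)[OF x]] by simp
    then show "\<exists>y. arr y V W \<and> y \<bullet>\<^bsub>A\<^esub> f = x" using cokernel_desc[OF c x] by blast
  qed
qed

lemma short_exact_epicI: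
  assumes "epic A U V f" "is_kernel A U V f N i" "U \<in> Ob A" "V \<in> Ob A"
  shows "short_exact A N U V i f"
  using assms cokernel_of_kernel by (simp add: short_exact_def)

text \<open>By normality \<open>f\<close> is the kernel of some \<open>h\<close>, and
  \<open>f\<close> being epic forces \<open>h = 0\<close>; then the identity of \<open>V\<close>
  lifts along \<open>f\<close>.\<close>

lemma monic_epic_right_inverse:
  assumes m: "monic A U V f" and e: "epic A U V f" and ob: "U \<in> Ob A" "V \<in> Ob A"
  obtains g where "arr g V U" "f \<bullet>\<^bsub>A\<^esub> g = ident A V"
proof -
  note f = monic_arr[OF m ob] and iV = arr_ident[OF ob(2)]
  obtain W h where W: "W \<in> Ob A" "h \<in> Hom A V W" and k: "is_kernel A V W h U f"
    using monic_normal[OF ob m] by blast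
  have h: "arr h V W" using W ob by (simp add: arr_def)
  have "h = zero_mor A V W" by (rule epic_zero[OF e ob(1) h kernel_cmp[OF k]])
  then have "h \<bullet>\<^bsub>A\<^esub> ident A V = zero_mor A V W" using id_right[OF h] by simp
  then show thesis using kernel_lift[OF k iV] that by blast
qed

text \<open>
  If \<open>x \<bullet> e = 0\<close>, then \<open>f\<close> factors through the smaller subobject \<open>ker x\<close>; being a kernel itself, this
  contains the kernel of every cokernel of \<open>f\<close>, that is, all of \<open>J\<close>.
\<close>

lemma image_epic:
  assumes f: "arr f U V" and c: "is_cokernel A U V f C c" and k: "is_kernel A V C c J j"
    and e: "arr e U J" and je: "j \<bullet>\<^bsub>A\<^esub> e = f"
  shows "epic A U J e"
proof (rule epicI[OF e])
  note V = arrD(2)[OF f]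
  note ac = cokernel_arr[OF c V] and aj = kernel_arr[OF k V]
  note J = arrD(1)[OF aj] and jm = kernel_monic[OF k ac]
  fix W x assume x: "arr x J W" and z: "x \<bullet>\<^bsub>A\<^esub> e = zero_mor A U W"
  obtain N n where n: "is_kernel A J W x N n"
    using ex_kernel[OF J arrD(2)[OF x] arrD(3)[OF x]] by blast
  note an = kernel_arr[OF n J] and nm = kernel_monic[OF n x]
  note N = arrD(1)[OF an] and ajn = arr_cmp[OF aj an]
  obtain e' where e': "arr e' U N" "n \<bullet>\<^bsub>A\<^esub> e' = e" using kernel_lift[OF n e z] .
  have jnm: "monic A N V (j \<bullet>\<^bsub>A\<^esub> n)"
  proof (rule monicI[OF ajn])
    fix T y assume y: "arr y T N" and "(j \<bullet>\<^bsub>A\<^esub> n) \<bullet>\<^bsub>A\<^esub> y = zero_mor A T V"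
    then have "j \<bullet>\<^bsub>A\<^esub> (n \<bullet>\<^bsub>A\<^esub> y) = zero_mor A T V" using assoc[OF aj an y] by simp
    then have "n \<bullet>\<^bsub>A\<^esub> y = zero_mor A T J" by (rule monic_zero[OF jm V arr_cmp[OF an y]])
    then show "y = zero_mor A T N" by (rule monic_zero[OF nm J y])
  qed
  obtain Y g where Y: "Y \<in> Ob A" "g \<in> Hom A V Y" and kg: "is_kernel A V Y g N (j \<bullet>\<^bsub>A\<^esub> n)"
    using monic_normal[OF N V jnm] by blast
  have g: "arr g V Y" using Y V by (simp add: arr_def)
  have "g \<bullet>\<^bsub>A\<^esub> f = (g \<bullet>\<^bsub>A\<^esub> (j \<bullet>\<^bsub>A\<^esub> n)) \<bullet>\<^bsub>A\<^esub> e'"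
    using assoc[OF g ajn e'(1)] assoc[OF aj an e'(1)] e'(2) je by simp
  also have "\<dots> = zero_mor A U Y" using kernel_cmp[OF kg] cmp_zero_left[OF e'(1) Y(1)] by simp
  finally obtain g' where g': "arr g' C Y" "g' \<bullet>\<^bsub>A\<^esub> c = g" using cokernel_desc[OF c g] by blast
  have "g \<bullet>\<^bsub>A\<^esub> j = zero_mor A J Y"
    using assoc[OF g'(1) ac aj] g'(2) kernel_cmp[OF k] cmp_zero_right[OF g'(1) J] by simp
  then obtain l where l: "arr l J N" "(j \<bullet>\<^bsub>A\<^esub> n) \<bullet>\<^bsub>A\<^esub> l = j" using kernel_lift[OF kg aj] by blast
  have nl: "n \<bullet>\<^bsub>A\<^esub> l = ident A J"
  proof (rule monic_cancel[OF jm arr_cmp[OF an l(1)] arr_ident[OF J]])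
    show "j \<bullet>\<^bsub>A\<^esub> (n \<bullet>\<^bsub>A\<^esub> l) = j \<bullet>\<^bsub>A\<^esub> ident A J"
      using assoc[OF aj an l(1)] l(2) id_right[OF aj] by simp
  qed
  have "x = (x \<bullet>\<^bsub>A\<^esub> n) \<bullet>\<^bsub>A\<^esub> l" using assoc[OF x an l(1)] nl id_right[OF x] by simp
  then show "x = zero_mor A J W" using kernel_cmp[OF n] cmp_zero_left[OF l(1) arrD(2)[OF x]] by simp
qed

text \<open>Modulo the image \<open>R\<close> of \<open>r\<close>, the map induced by
  \<open>p\<close> kills \<open>T\<close> and so factors through \<open>F\<close>. Since
  \<open>p\<close> is epic, the quotient map by \<open>R\<close> itself factors through
  \<open>F\<close>, so \<open>T1\<close> vanishes modulo \<open>R\<close>. In terms of elements,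
  \<open>T\<close> is the preimage of \<open>T1\<close> under \<open>p\<close>.\<close>

lemma kernel_restriction_epic:
  assumes p: "epic A M M1 p" and se: "short_exact A T1 M1 F t q"
    and k: "is_kernel A M F (q \<bullet>\<^bsub>A\<^esub> p) T k" and r: "arr r T T1" and tr: "t \<bullet>\<^bsub>A\<^esub> r = p \<bullet>\<^bsub>A\<^esub> k"
    and ob: "M \<in> Ob A" "M1 \<in> Ob A" "T1 \<in> Ob A" "F \<in> Ob A"
  shows "epic A T T1 r"
proof -
  have kt: "is_kernel A M1 F q T1 t" and cq: "is_cokernel A T1 M1 t F q"
    using se by (auto simp: short_exact_def)
  note at = kernel_arr[OF kt ob(2)] and aq = cokernel_arr[OF cq ob(2)]
    and ap = epic_arr[OF p ob(1,2)] and ak = kernel_arr[OF k ob(1)]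
  note tm = kernel_monic[OF kt aq] and qe = cokernel_epic[OF cq at] and T = arrD(1)[OF r]
  have ck: "is_cokernel A T M k F (q \<bullet>\<^bsub>A\<^esub> p)"
    by (rule cokernel_of_kernel[OF epic_cmp[OF p qe] k]) (use ob in auto)
  \<comment> \<open>Image factorization \<open>r = a b\<close>: \<open>R\<close> is the kernel of
    the cokernel of \<open>r\<close>.\<close>
  obtain Y y where y: "is_cokernel A T T1 r Y y"
    using ex_cokernel[OF T ob(3) arrD(3)[OF r]] by blast
  note ay = cokernel_arr[OF y ob(3)]
  obtain R a where a: "is_kernel A T1 Y y R a"
    using ex_kernel[OF ob(3) arrD(2)[OF ay] arrD(3)[OF ay]] by blast
  note aa = kernel_arr[OF a ob(3)] and am = kernel_monic[OF a ay]
  note R = arrD(1)[OF aa] and ata = arr_cmp[OF at aa]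
  obtain b where b: "arr b T R" "a \<bullet>\<^bsub>A\<^esub> b = r" using kernel_lift[OF a r cokernel_cmp[OF y]] .
  have be: "epic A T R b" by (rule image_epic[OF r y a b])
  have tam: "monic A R M1 (t \<bullet>\<^bsub>A\<^esub> a)"
  proof (rule monicI[OF ata])
    fix S x assume x: "arr x S R" and "(t \<bullet>\<^bsub>A\<^esub> a) \<bullet>\<^bsub>A\<^esub> x = zero_mor A S M1"
    then have "t \<bullet>\<^bsub>A\<^esub> (a \<bullet>\<^bsub>A\<^esub> x) = zero_mor A S M1" using assoc[OF at aa x] by simp
    then have "a \<bullet>\<^bsub>A\<^esub> x = zero_mor A S T1" by (rule monic_zero[OF tm ob(2) arr_cmp[OF aa x]])
    then show "x = zero_mor A S R" by (rule monic_zero[OF am ob(3) x])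
  qed
  \<comment> \<open>\<open>Z\<close> is \<open>M1 / R\<close>, with \<open>R\<close> embedded
    through \<open>T1\<close>.\<close>
  obtain Z z where z: "is_cokernel A R M1 (t \<bullet>\<^bsub>A\<^esub> a) Z z"
    using ex_cokernel[OF R ob(2) arrD(3)[OF ata]] by blast
  note az = cokernel_arr[OF z ob(2)]
  note Z = arrD(2)[OF az] and azp = arr_cmp[OF az ap]
  have "(z \<bullet>\<^bsub>A\<^esub> p) \<bullet>\<^bsub>A\<^esub> k = z \<bullet>\<^bsub>A\<^esub> (t \<bullet>\<^bsub>A\<^esub> (a \<bullet>\<^bsub>A\<^esub> b))"
    using assoc[OF az ap ak] tr b(2) by simp
  also have "\<dots> = (z \<bullet>\<^bsub>A\<^esub> (t \<bullet>\<^bsub>A\<^esub> a)) \<bullet>\<^bsub>A\<^esub> b"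
    using assoc[OF az ata b(1)] assoc[OF at aa b(1)] by simp
  also have "\<dots> = zero_mor A T Z" using cokernel_cmp[OF z] cmp_zero_left[OF b(1) Z] by simp
  finally obtain z' where z': "arr z' F Z" "z' \<bullet>\<^bsub>A\<^esub> (q \<bullet>\<^bsub>A\<^esub> p) = z \<bullet>\<^bsub>A\<^esub> p"
    using cokernel_desc[OF ck azp] by blast
  have "z = z' \<bullet>\<^bsub>A\<^esub> q"
    by (rule epic_cancel[OF p az arr_cmp[OF z'(1) aq]]) (use assoc[OF z'(1) aq ap] z'(2) in simp)
  then have "z \<bullet>\<^bsub>A\<^esub> t = zero_mor A T1 Z"
    using assoc[OF z'(1) aq at] kernel_cmp[OF kt] cmp_zero_right[OF z'(1) ob(3)] by simp
  \<comment> \<open>The monic \<open>t a\<close> is the kernel of \<open>z\<close>, and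
    \<open>z\<close> kills \<open>t\<close>, so \<open>T1\<close> lies in \<open>R\<close>; the lift
    \<open>w\<close> splits \<open>a\<close>.\<close>
  then obtain w where w: "arr w T1 R" "(t \<bullet>\<^bsub>A\<^esub> a) \<bullet>\<^bsub>A\<^esub> w = t"
    using kernel_lift[OF kernel_of_cokernel[OF tam z R ob(2)] at] by blast
  have "a \<bullet>\<^bsub>A\<^esub> w = ident A T1"
  proof (rule monic_cancel[OF tm arr_cmp[OF aa w(1)] arr_ident[OF ob(3)]])
    show "t \<bullet>\<^bsub>A\<^esub> (a \<bullet>\<^bsub>A\<^esub> w) = t \<bullet>\<^bsub>A\<^esub> ident A T1"
      using assoc[OF at aa w(1)] w(2) id_right[OF at] by simp
  qed
  then have "epic A R T1 a" by (rule split_epic[OF aa w(1)])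
  from epic_cmp[OF be this T R ob(3)] show ?thesis using b(2) by simp
qed


section \<open>Length\<close>

text \<open>Zero objects are included.\<close>

definition cosimple :: "'o \<Rightarrow> bool" where
  "cosimple S \<longleftrightarrow> S \<in> Ob A \<and>
     (\<forall>Q\<in>Ob A. \<forall>e. epic A S Q e \<longrightarrow> monic A S Q e \<or> e = zero_mor A S Q)"

text \<open>\<open>simple_obj\<close> controls subobjects, while the length argument passes to
  quotients; the kernel of \<open>e\<close> translates between them. If it is zero, then
  \<open>e\<close> is monic; if it is all of \<open>S\<close>, then \<open>e\<close> is
  zero.\<close>

lemma simple_cosimple:
  assumes "simple_obj A S"
  shows "cosimple S"
proof -
  have S: "S \<in> Ob A" using assms by (simp add: simple_obj_def)
  have "monic A S Q e" if Q: "Q \<in> Ob A" and ee: "epic A S Q e" and nz: "e \<noteq> zero_mor A S Q" for Q e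
  proof -
    note e = epic_arr[OF ee S Q]
    obtain N n where n: "is_kernel A S Q e N n" using ex_kernel[OF S Q arrD(3)[OF e]] by blast
    note an = kernel_arr[OF n S] and nm = kernel_monic[OF n e]
    have "zero_obj A N \<or> isomorphism A N S n"
      using assms nm arrD(1)[OF an] by (simp add: simple_obj_def)
    then show ?thesis
    proof
      assume N: "zero_obj A N"
      show ?thesis
      proof (rule monicI[OF e])
        fix T g assume g: "arr g T S" and z: "e \<bullet>\<^bsub>A\<^esub> g = zero_mor A T Q"
        obtain h where h: "arr h T N" "n \<bullet>\<^bsub>A\<^esub> h = g" using kernel_lift[OF n g z] .
        then show "g = zero_mor A T S"
          using zero_objD(1)[OF N h(1)] cmp_zero_right[OF an arrD(1)[OF g]] by simp
      qed
    next
      assume "isomorphism A N S n"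
      then obtain g where "g \<in> Hom A S N" and ng: "n \<bullet>\<^bsub>A\<^esub> g = ident A S"
        unfolding isomorphism_def by blast
      then have g: "arr g S N" using S an by (simp add: arr_def)
      have "e = (e \<bullet>\<^bsub>A\<^esub> n) \<bullet>\<^bsub>A\<^esub> g" using assoc[OF e an g] ng id_right[OF e] by simp
      then have "e = zero_mor A S Q" using kernel_cmp[OF n] cmp_zero_left[OF g Q] by simp
      with nz show ?thesis by simp
    qed
  qed
  with S show ?thesis unfolding cosimple_def by blast
qed

text \<open>As \<open>s\<close> is in effect an isomorphism, a quotient \<open>e\<close> of
  \<open>C\<close> is tested through the quotient \<open>e s\<close> of \<open>S\<close> and a right
  inverse \<open>v\<close> of \<open>s\<close>.\<close>

lemma cosimple_quotient:
  assumes S: "cosimple S" and s: "epic A S C s" "monic A S C s" and C: "C \<in> Ob A"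
  shows "cosimple C"
proof -
  have So: "S \<in> Ob A" using S by (simp add: cosimple_def)
  note as = epic_arr[OF s(1) So C]
  obtain v where v: "arr v C S" "s \<bullet>\<^bsub>A\<^esub> v = ident A C" using monic_epic_right_inverse[OF s(2,1) So C] by blast
  have "monic A C Q e" if Q: "Q \<in> Ob A" and ee: "epic A C Q e" and nz: "e \<noteq> zero_mor A C Q" for Q e
  proof -
    note e = epic_arr[OF ee C Q]
    have "e \<bullet>\<^bsub>A\<^esub> s \<noteq> zero_mor A S Q" using epic_zero[OF s(1) So e] nz by blast
    then have m: "monic A S Q (e \<bullet>\<^bsub>A\<^esub> s)"
      using S epic_cmp[OF s(1) ee So C Q] Q unfolding cosimple_def by blast
    show ?thesis
    proof (rule monicI[OF e])
      fix T g assume g: "arr g T C" and z: "e \<bullet>\<^bsub>A\<^esub> g = zero_mor A T Q"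
      note vg = arr_cmp[OF v(1) g]
      have svg: "s \<bullet>\<^bsub>A\<^esub> (v \<bullet>\<^bsub>A\<^esub> g) = g" using assoc[OF as v(1) g] v(2) id_left[OF g] by simp
      then have "(e \<bullet>\<^bsub>A\<^esub> s) \<bullet>\<^bsub>A\<^esub> (v \<bullet>\<^bsub>A\<^esub> g) = zero_mor A T Q" using assoc[OF e as vg] z by simp
      then have "v \<bullet>\<^bsub>A\<^esub> g = zero_mor A T S" by (rule monic_zero[OF m Q vg])
      then show "g = zero_mor A T C" using svg cmp_zero_right[OF as arrD(1)[OF g]] by simp
    qed
  qed
  with C show ?thesis unfolding cosimple_def by blast
qed

text \<open>
  A relation rather than a function, which avoids the Jordan--Hoelder theorem.
\<close>

inductive len :: "nat \<Rightarrow> 'o \<Rightarrow> bool" where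
  len_zero: "zero_obj A M \<Longrightarrow> len 0 M"
| len_Suc: "\<lbrakk>len n U; U \<in> Ob A; M \<in> Ob A; cosimple S; short_exact A U M S i p\<rbrakk> \<Longrightarrow> len (Suc n) M"

text \<open>Climbing a composition series, each simple factor is one use of
  \<open>len_Suc\<close>.\<close>

lemma finite_length_len:
  assumes "finite_length A M"
  obtains n where "len n M"
proof -
  obtain n :: nat and U S i p where ob: "\<forall>j\<le>n. U j \<in> Ob A" and z: "zero_obj A (U 0)" and M: "U n = M"
    and s: "\<forall>j<n. simple_obj A (S j) \<and> short_exact A (U j) (U (Suc j)) (S j) (i j) (p j)"
    using assms unfolding finite_length_def by blast
  have "len j (U j)" if "j \<le> n" for j
    using that
  proof (induction j)
    case 0
    show ?case using z by (rule len_zero)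
  next
    case (Suc j)
    then have j: "j < n" by simp
    show ?case
      by (rule len_Suc[OF Suc.IH]) (use j ob s simple_cosimple in auto)
  qed
  then show thesis using that M by blast
qed

text \<open>Filter \<open>Q\<close> by the image of \<open>U\<close>, with quotient
  \<open>C\<close>, which is a quotient of \<open>S\<close>. If \<open>C\<close> vanishes,
  \<open>Q\<close> is already a quotient of \<open>U\<close>; otherwise \<open>C\<close> is a copy
  of \<open>S\<close>, and the length of the image rises by one. The clause on equality makes
  quotients by nonzero subobjects strictly shorter, which drives the torsion decomposition.\<close>

lemma len_quotient:
  assumes "len n M" and "M \<in> Ob A" and "epic A M Q e" and "Q \<in> Ob A"
  shows "\<exists>m\<le>n. len m Q \<and> (m = n \<longrightarrow> monic A M Q e)"
  using assms
proof (induction arbitrary: Q e rule: len.induct)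
  case (len_zero M)
  note e = epic_arr[OF len_zero(3,2,4)]
  \<comment> \<open>All maps out of \<open>M\<close> vanish, so cancelling the epic \<open>e\<close>
    makes the identity of \<open>Q\<close> zero.\<close>
  have "ident A Q \<bullet>\<^bsub>A\<^esub> e = zero_mor A M Q"
    using zero_objD(2)[OF len_zero(1)] arr_cmp[OF arr_ident[OF len_zero(4)] e] by blast
  then have "ident A Q = zero_mor A Q Q"
    by (rule epic_zero[OF len_zero(3,2) arr_ident[OF len_zero(4)]])
  then have "len 0 Q" using len_zero(4) by (intro len.len_zero zero_objI)
  moreover have "monic A M Q e" by (rule monicI[OF e]) (rule zero_objD(1)[OF len_zero(1)])
  ultimately show ?case by blast
next
  case (len_Suc n U M S i p)
  note U = \<open>U \<in> Ob A\<close> and M = \<open>M \<in> Ob A\<close> and Q = \<open>Q \<in> Ob A\<close> and ee = \<open>epic A M Q e\<close>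
  have S: "S \<in> Ob A" using \<open>cosimple S\<close> by (simp add: cosimple_def)
  have ki: "is_kernel A M S p U i" and cp: "is_cokernel A U M i S p"
    using \<open>short_exact A U M S i p\<close> by (auto simp: short_exact_def)
  note ai = kernel_arr[OF ki M] and ap = cokernel_arr[OF cp M] and ae = epic_arr[OF ee M Q]
  note d = arr_cmp[OF ae ai]
  obtain C c where c: "is_cokernel A U Q (e \<bullet>\<^bsub>A\<^esub> i) C c"
    using ex_cokernel[OF U Q arrD(3)[OF d]] by blast
  note ac = cokernel_arr[OF c Q] and ce = cokernel_epic[OF c d]
  note C = arrD(2)[OF ac]
  show ?case
  \<comment> \<open>As \<open>c\<close> is epic, it is zero only if \<open>C\<close> is a zero
    object, that is, if \<open>U\<close> already maps onto \<open>Q\<close>.\<close>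
  proof (cases "c = zero_mor A Q C")
    case True
    have "epic A U Q (e \<bullet>\<^bsub>A\<^esub> i)"
    proof (rule epicI[OF d])
      fix W x assume x: "arr x Q W" and z: "x \<bullet>\<^bsub>A\<^esub> (e \<bullet>\<^bsub>A\<^esub> i) = zero_mor A U W"
      obtain h where h: "arr h C W" "h \<bullet>\<^bsub>A\<^esub> c = x" using cokernel_desc[OF c x z] .
      then show "x = zero_mor A Q W" using True cmp_zero_right[OF h(1) Q] by simp
    qed
    from len_Suc.IH[OF U this Q] obtain m where "m \<le> n" "len m Q" by blast
    \<comment> \<open>Here \<open>m \<le> n < Suc n\<close>, so the clause on equality holds
      vacuously.\<close>
    then show ?thesis by (intro exI[of _ m]) auto
  next
    case False
    obtain J j where j: "is_kernel A Q C c J j" using ex_kernel[OF Q C arrD(3)[OF ac]] by blast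
    note aj = kernel_arr[OF j Q]
    note J = arrD(1)[OF aj]
    obtain d' where d': "arr d' U J" "j \<bullet>\<^bsub>A\<^esub> d' = e \<bullet>\<^bsub>A\<^esub> i"
      using kernel_lift[OF j d cokernel_cmp[OF c]] .
    have "epic A U J d'" by (rule image_epic[OF d c j d'])
    from len_Suc.IH[OF U this J] obtain m where m: "m \<le> n" "len m J"
      and mn: "m = n \<Longrightarrow> monic A U J d'" by blast
    note ace = arr_cmp[OF ac ae]
    have "(c \<bullet>\<^bsub>A\<^esub> e) \<bullet>\<^bsub>A\<^esub> i = zero_mor A U C" using assoc[OF ac ae ai] cokernel_cmp[OF c] by simp
    \<comment> \<open>The map induced by \<open>e\<close> on the quotients \<open>M / U = S\<close>
      and \<open>Q / J = C\<close>.\<close>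
    then obtain s where s: "arr s S C" "s \<bullet>\<^bsub>A\<^esub> p = c \<bullet>\<^bsub>A\<^esub> e" using cokernel_desc[OF cp ace] by blast
    have cee: "epic A M C (c \<bullet>\<^bsub>A\<^esub> e)" by (rule epic_cmp[OF ee ce M Q C])
    have se: "epic A S C s" by (rule epic_right_factor[OF ap s(1)]) (use cee s(2) in simp)
    have "s \<noteq> zero_mor A S C"
    proof
      assume "s = zero_mor A S C"
      then have "c \<bullet>\<^bsub>A\<^esub> e = zero_mor A M C" using s(2) cmp_zero_left[OF ap C] by simp
      then show False using epic_zero[OF ee M ac] False by blast
    qed
    then have sm: "monic A S C s" using \<open>cosimple S\<close> se C unfolding cosimple_def by blast
    have "len (Suc m) Q"
      by (rule len.len_Suc[OF m(2) J Q cosimple_quotient[OF \<open>cosimple S\<close> se sm C]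
            short_exact_epicI[OF ce j Q C]])
    \<comment> \<open>A chase in the ladder whose outer maps \<open>d'\<close> and \<open>s\<close>
      are monic: \<open>p g\<close> vanishes because of \<open>s\<close>, so \<open>g\<close> comes
      from a map \<open>h\<close> into \<open>U\<close>, which vanishes because of
      \<open>d'\<close>.\<close>
    moreover have "monic A M Q e" if "Suc m = Suc n"
    proof (rule monicI[OF ae])
      have dm: "monic A U J d'" using that mn by simp
      fix T g assume g: "arr g T M" and z: "e \<bullet>\<^bsub>A\<^esub> g = zero_mor A T Q"
      note T = arrD(1)[OF g]
      have "s \<bullet>\<^bsub>A\<^esub> (p \<bullet>\<^bsub>A\<^esub> g) = c \<bullet>\<^bsub>A\<^esub> (e \<bullet>\<^bsub>A\<^esub> g)"
        using assoc[OF s(1) ap g] assoc[OF ac ae g] s(2) by simp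
      then have "s \<bullet>\<^bsub>A\<^esub> (p \<bullet>\<^bsub>A\<^esub> g) = zero_mor A T C" using z cmp_zero_right[OF ac T] by simp
      then have "p \<bullet>\<^bsub>A\<^esub> g = zero_mor A T S" by (rule monic_zero[OF sm C arr_cmp[OF ap g]])
      then obtain h where h: "arr h T U" "i \<bullet>\<^bsub>A\<^esub> h = g" using kernel_lift[OF ki g] by blast
      have "j \<bullet>\<^bsub>A\<^esub> (d' \<bullet>\<^bsub>A\<^esub> h) = e \<bullet>\<^bsub>A\<^esub> g"
        using assoc[OF aj d'(1) h(1)] assoc[OF ae ai h(1)] d'(2) h(2) by simp
      then have "d' \<bullet>\<^bsub>A\<^esub> h = zero_mor A T J"
        using z monic_zero[OF kernel_monic[OF j ac] Q arr_cmp[OF d'(1) h(1)]] by simp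
      then have "h = zero_mor A T U" by (rule monic_zero[OF dm J h(1)])
      then show "g = zero_mor A T M" using h(2) cmp_zero_right[OF ai T] by simp
    qed
    ultimately show ?thesis using m(1) by (intro exI[of _ "Suc m"]) auto
  qed
qed


section \<open>Torsion pairs\<close>

lemma Hom_trivialI:
  assumes "U \<in> Ob A" "V \<in> Ob A" "\<And>f. arr f U V \<Longrightarrow> f = zero_mor A U V"
  shows "Hom A U V = {zero_mor A U V}"
  using assms arr_zero unfolding arr_def by blast

lemma Hom_trivialD:
  assumes "Hom A U V = {zero_mor A U V}" "arr f U V"
  shows "f = zero_mor A U V"
  using assms unfolding arr_def by blast

text \<open>Strong induction on a length of \<open>M\<close>: the torsion part of the cokernel of
  one nonzero map from a generator is pulled back to \<open>M\<close>.\<close>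

lemma torsion_decomposition:
  assumes "len n M" and "M \<in> Ob A" and C: "C \<subseteq> Ob A"
  shows "\<exists>T\<in>gen_tors A C. \<exists>F\<in>rperp A C. \<exists>f g. short_exact A T M F f g"
  using assms(1,2)
proof (induction n arbitrary: M rule: less_induct)
  case (less n)
  note M = \<open>M \<in> Ob A\<close>
  show ?case
  proof (cases "M \<in> rperp A C")
    case True
    \<comment> \<open>The torsion part is zero here; a zero object lies in every left perpendicular
      class.\<close>
    obtain Z where Z: "zero_obj A Z" using ex_zero by blast
    have Zo: "Z \<in> Ob A" using Z by (simp add: zero_obj_def)
    have "Hom A Z Y = {zero_mor A Z Y}" if "Y \<in> rperp A C" for Y
      by (rule Hom_trivialI[OF Zo _ zero_objD(2)[OF Z]]) (use that in \<open>simp add: rperp_def\<close>)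
    then have "Z \<in> gen_tors A C" using Zo by (simp add: gen_tors_def lperp_def)
    with True short_exact_zero[OF Z M] show ?thesis by blast
  next
    case False
    then obtain U where UC: "U \<in> C" and "Hom A U M \<noteq> {zero_mor A U M}"
      using M unfolding rperp_def by blast
    moreover have U: "U \<in> Ob A" using UC C by blast
    ultimately obtain f where f: "arr f U M" and nz: "f \<noteq> zero_mor A U M"
      using Hom_trivialI[OF _ M] by blast
    obtain M1 p where p: "is_cokernel A U M f M1 p" using ex_cokernel[OF U M arrD(3)[OF f]] by blast
    note ap = cokernel_arr[OF p M] and pe = cokernel_epic[OF p f]
    note M1 = arrD(2)[OF ap]
    \<comment> \<open>\<open>p\<close> kills the nonzero \<open>f\<close>, so it is not monic, and
      the equality clause of \<open>len_quotient\<close> excludes \<open>m = n\<close>.\<close>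
    have "\<not> monic A M M1 p" using monic_zero[OF _ M1 f cokernel_cmp[OF p]] nz by blast
    then obtain m where "m < n" "len m M1"
      using len_quotient[OF less.prems(1) M pe M1] le_neq_implies_less by blast
    from less.IH[OF this M1] obtain T1 F t q where T1: "T1 \<in> gen_tors A C" and F: "F \<in> rperp A C"
      and se: "short_exact A T1 M1 F t q" by blast
    have T1o: "T1 \<in> Ob A" and Fo: "F \<in> Ob A" using T1 F by (auto simp: gen_tors_def lperp_def rperp_def)
    have kt: "is_kernel A M1 F q T1 t" and cq: "is_cokernel A T1 M1 t F q"
      using se by (auto simp: short_exact_def)
    note at = kernel_arr[OF kt M1] and aq = cokernel_arr[OF cq M1]
    note qe = cokernel_epic[OF cq at] and aqp = arr_cmp[OF aq ap]
    note qpe = epic_cmp[OF pe qe M M1 Fo]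
    \<comment> \<open>\<open>T\<close> is the preimage in \<open>M\<close> of the torsion part
      \<open>T1\<close> of \<open>M1\<close>; it becomes the torsion part of
      \<open>M\<close>.\<close>
    obtain T k where k: "is_kernel A M F (q \<bullet>\<^bsub>A\<^esub> p) T k"
      using ex_kernel[OF M Fo arrD(3)[OF aqp]] by blast
    note ak = kernel_arr[OF k M] and km = kernel_monic[OF k aqp]
    note T = arrD(1)[OF ak] and apk = arr_cmp[OF ap ak]
    have "q \<bullet>\<^bsub>A\<^esub> (p \<bullet>\<^bsub>A\<^esub> k) = zero_mor A T F" using assoc[OF aq ap ak] kernel_cmp[OF k] by simp
    then obtain r where r: "arr r T T1" "t \<bullet>\<^bsub>A\<^esub> r = p \<bullet>\<^bsub>A\<^esub> k" using kernel_lift[OF kt apk] by blast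
    have re: "epic A T T1 r" by (rule kernel_restriction_epic[OF pe se k r M M1 T1o Fo])
    \<comment> \<open>\<open>I\<close> is the image of \<open>f\<close>; as a quotient of
      \<open>U\<close> it has only zero maps to objects of \<open>rperp A C\<close>.\<close>
    obtain I i where i: "is_kernel A M M1 p I i" using ex_kernel[OF M M1 arrD(3)[OF ap]] by blast
    note ai = kernel_arr[OF i M]
    note I = arrD(1)[OF ai]
    obtain e where e: "arr e U I" "i \<bullet>\<^bsub>A\<^esub> e = f" using kernel_lift[OF i f cokernel_cmp[OF p]] .
    have ee: "epic A U I e" by (rule image_epic[OF f p i e])
    have "(q \<bullet>\<^bsub>A\<^esub> p) \<bullet>\<^bsub>A\<^esub> i = zero_mor A I F"
      using assoc[OF aq ap ai] kernel_cmp[OF i] cmp_zero_right[OF aq I] by simp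
    then obtain i' where i': "arr i' I T" "k \<bullet>\<^bsub>A\<^esub> i' = i" using kernel_lift[OF k ai] by blast
    \<comment> \<open>The kernel \<open>N\<close> of \<open>r\<close> maps to zero in
      \<open>M1\<close>, so its inclusion factors through \<open>I\<close>; thus maps out of
      \<open>T\<close> are governed by \<open>I\<close> and \<open>T1\<close>.\<close>
    obtain N n where n: "is_kernel A T T1 r N n" using ex_kernel[OF T T1o arrD(3)[OF r(1)]] by blast
    note an = kernel_arr[OF n T]
    note N = arrD(1)[OF an] and akn = arr_cmp[OF ak an]
    have "p \<bullet>\<^bsub>A\<^esub> (k \<bullet>\<^bsub>A\<^esub> n) = t \<bullet>\<^bsub>A\<^esub> (r \<bullet>\<^bsub>A\<^esub> n)"
      using assoc[OF ap ak an] assoc[OF at r(1) an] r(2) by simp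
    then have "p \<bullet>\<^bsub>A\<^esub> (k \<bullet>\<^bsub>A\<^esub> n) = zero_mor A N M1"
      using kernel_cmp[OF n] cmp_zero_right[OF at N] by simp
    then obtain h where h: "arr h N I" "i \<bullet>\<^bsub>A\<^esub> h = k \<bullet>\<^bsub>A\<^esub> n" using kernel_lift[OF i akn] by blast
    have nh: "n = i' \<bullet>\<^bsub>A\<^esub> h"
      by (rule monic_cancel[OF km an arr_cmp[OF i'(1) h(1)]])
        (use assoc[OF ak i'(1) h(1)] i'(2) h(2) in simp)
    have rc: "is_cokernel A N T n T1 r" by (rule cokernel_of_kernel[OF re n T T1o])
    have "T \<in> gen_tors A C"
      unfolding gen_tors_def lperp_def
    proof (intro CollectI conjI ballI T)
      fix Y assume Y: "Y \<in> rperp A C"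
      then have Xo: "Y \<in> Ob A" and UX: "Hom A U Y = {zero_mor A U Y}"
        using UC by (auto simp: rperp_def)
      show "Hom A T Y = {zero_mor A T Y}"
      proof (rule Hom_trivialI[OF T Xo])
        \<comment> \<open>\<open>g\<close> vanishes on \<open>I\<close> because \<open>U\<close>
          maps onto \<open>I\<close>, hence on \<open>N\<close>; it then descends to
          \<open>T1\<close>, from which every map to \<open>Y\<close> is zero.\<close>
        fix g assume g: "arr g T Y"
        note gi = arr_cmp[OF g i'(1)]
        have "(g \<bullet>\<^bsub>A\<^esub> i') \<bullet>\<^bsub>A\<^esub> e = zero_mor A U Y" by (rule Hom_trivialD[OF UX arr_cmp[OF gi e(1)]])
        then have "g \<bullet>\<^bsub>A\<^esub> i' = zero_mor A I Y" by (rule epic_zero[OF ee U gi])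
        then have "g \<bullet>\<^bsub>A\<^esub> n = zero_mor A N Y"
          using nh assoc[OF g i'(1) h(1)] cmp_zero_left[OF h(1) Xo] by simp
        then obtain g' where g': "arr g' T1 Y" "g' \<bullet>\<^bsub>A\<^esub> r = g" using cokernel_desc[OF rc g] by blast
        have "Hom A T1 Y = {zero_mor A T1 Y}" using T1 Y by (simp add: gen_tors_def lperp_def)
        then have "g' = zero_mor A T1 Y" by (rule Hom_trivialD[OF _ g'(1)])
        then show "g = zero_mor A T Y" using g'(2) cmp_zero_left[OF r(1) Xo] by simp
      qed
    qed
    with F short_exact_epicI[OF qpe k M Fo] show ?thesis by blast
  qed
qed

text \<open>The identity is nonzero, since an object with zero identity is a zero object.\<close>

lemma Hom_self_nontrivial:
  assumes "U \<in> Ob A" "\<not> zero_obj A U"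
  shows "Hom A U U \<noteq> {zero_mor A U U}"
  using assms Hom_trivialD arr_ident zero_objI by blast

end

section \<open>The Galois connection between left and right perpendicular classes\<close>

lemma subset_gen_tors: "C \<subseteq> Ob A \<Longrightarrow> C \<subseteq> gen_tors A C"
  by (auto simp: gen_tors_def lperp_def rperp_def)

lemma subset_gen_torsfree: "C \<subseteq> Ob A \<Longrightarrow> C \<subseteq> gen_torsfree A C"
  by (auto simp: gen_torsfree_def lperp_def rperp_def)

lemma rperp_antimono: "C \<subseteq> D \<Longrightarrow> rperp A D \<subseteq> rperp A C"
  by (auto simp: rperp_def)

lemma lperp_antimono: "C \<subseteq> D \<Longrightarrow> lperp A D \<subseteq> lperp A C"
  by (auto simp: lperp_def)

text \<open>The closure law of a Galois connection: \<open>lperp\<close>, \<open>rperp\<close>,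
  \<open>lperp\<close> in turn amount to a single \<open>lperp\<close>.\<close>

lemma gen_tors_lperp:
  assumes "C \<subseteq> Ob A"
  shows "gen_tors A (lperp A C) = lperp A C"
proof
  show "gen_tors A (lperp A C) \<subseteq> lperp A C"
    using lperp_antimono[OF subset_gen_torsfree[OF assms]] by (simp add: gen_tors_def gen_torsfree_def)
  show "lperp A C \<subseteq> gen_tors A (lperp A C)"
    by (rule subset_gen_tors) (auto simp: lperp_def)
qed

section \<open>Torsion pairs determined by a class of objects\<close>

context abelian_length_category
begin

text \<open>Orthogonality is built into \<open>gen_tors\<close>; the exact sequences come from
  \<open>torsion_decomposition\<close>, applied with a length of each object.\<close>

lemma torsion_pair_gen_tors:
  assumes "C \<subseteq> Ob A"
  shows "torsion_pair A (gen_tors A C, rperp A C)"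
proof -
  have "\<exists>T\<in>gen_tors A C. \<exists>F\<in>rperp A C. \<exists>f g. short_exact A T M F f g" if "M \<in> Ob A" for M
    using finite_length_len[OF all_finite_length[OF that]] torsion_decomposition[OF _ that assms]
    by metis
  then show ?thesis
    by (auto simp: torsion_pair_def gen_tors_def lperp_def rperp_def)
qed

text \<open>For the class \<open>D = lperp A C\<close>, \<open>rperp A D\<close> is
  \<open>gen_torsfree A C\<close> by definition, and \<open>gen_tors A D\<close> collapses to
  \<open>D\<close>.\<close>

lemma torsion_pair_gen_torsfree:
  assumes "C \<subseteq> Ob A"
  shows "torsion_pair A (lperp A C, gen_torsfree A C)"
  using torsion_pair_gen_tors[of "lperp A C"] gen_tors_lperp[OF assms]
  by (auto simp: gen_torsfree_def lperp_def)

end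

section \<open>The two nested families induced by a graded object\<close>

theorem theorem4p5:
  fixes K :: "'k ring"
    and A :: "('k, 'o, 'm) lincat"
    and M :: "'g::linorder \<Rightarrow> 'o"
    and \<Gamma> \<Gamma>' :: "'g \<Rightarrow> 'o set \<times> 'o set"
  assumes "abelian_length_category K A"
    and "M \<in> Ob (Gr A)"
    and "\<And>k. \<not> zero_obj A (M k)"
    and "\<And>i j. j > i \<Longrightarrow> Hom A (M j) (M i) = {zero_mor A (M j) (M i)}"
    and "\<Gamma> = (\<lambda>k. (gen_tors A {M j |j. j \<ge> k}, rperp A {M j |j. j \<ge> k}))"
    and "\<Gamma>' = (\<lambda>k. (lperp A {M j |j. j \<le> k}, gen_torsfree A {M j |j. j \<le> k}))"
  shows "T_induces A M \<Gamma> \<and> F_induces A M \<Gamma>' \<and> \<Gamma> \<noteq> \<Gamma>' \<and>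
    M \<in> MM_star A \<Gamma> \<inter> NN_star A \<Gamma>'"
proof -
  interpret abelian_length_category K A by (rule assms(1))
  have M: "M k \<in> Ob A" for k using assms(2) by (simp add: Gr_def)
  have self: "Hom A (M k) (M k) \<noteq> {zero_mor A (M k) (M k)}" for k
    by (rule Hom_self_nontrivial[OF M assms(3)])
  have ge: "{M j |j. j \<ge> k} \<subseteq> Ob A" and le: "{M j |j. j \<le> k} \<subseteq> Ob A" for k using M by auto
  have T: "M k \<in> fst (\<Gamma> k)" for k
    using subset_gen_tors[OF ge[of k]] by (auto simp: assms(5))
  \<comment> \<open>Each generator \<open>M i\<close> of the class at \<open>j\<close> has
    \<open>i \<ge> j > k\<close>, so it has no nonzero map to \<open>M k\<close>.\<close>
  have F: "M k \<in> snd (\<Gamma> j)" if "k < j" for k j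
    using that assms(4) M by (auto simp: assms(5) rperp_def)
  \<comment> \<open>Otherwise \<open>M k\<close> would be torsion and torsion-free for the same
    pair, and its identity would vanish.\<close>
  have nT: "M k \<notin> fst (\<Gamma> j)" if "k < j" for k j
    using F[OF that] self[of k] by (auto simp: assms(5) gen_tors_def lperp_def)
  have F': "M k \<in> snd (\<Gamma>' k)" for k
    using subset_gen_torsfree[OF le[of k]] by (auto simp: assms(6))
  have T': "M k \<in> fst (\<Gamma>' j)" if "j < k" for k j
    using that assms(4) M by (auto simp: assms(6) lperp_def)
  have nF': "M k \<notin> snd (\<Gamma>' j)" if "j < k" for k j
    using T'[OF that] self[of k] by (auto simp: assms(6) gen_torsfree_def rperp_def)
  \<comment> \<open>The index \<open>k\<close> itself satisfies \<open>j \<le> k\<close>, so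
    membership would kill the identity of \<open>M k\<close>.\<close>
  have nT': "M k \<notin> fst (\<Gamma>' k)" for k
    using self[of k] by (auto simp: assms(6) lperp_def)
  have "fst (\<Gamma> l) \<subset> fst (\<Gamma> k)" if "k < l" for k l
  proof -
    have "{M j |j. j \<ge> l} \<subseteq> {M j |j. j \<ge> k}" using that by force
    then have "fst (\<Gamma> l) \<subseteq> fst (\<Gamma> k)"
      unfolding assms(5) gen_tors_def fst_conv by (intro lperp_antimono rperp_antimono)
    \<comment> \<open>\<open>M k\<close> at the smaller index separates the two torsion
      classes.\<close>
    then show ?thesis using T[of k] nT[OF that] by blast
  qed
  then have "nested_family A \<Gamma>"
    using torsion_pair_gen_tors[OF ge] by (simp add: nested_family_def assms(5))
  moreover have "fst (\<Gamma>' l) \<subset> fst (\<Gamma>' k)" if "k < l" for k l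
  proof -
    have "{M j |j. j \<le> k} \<subseteq> {M j |j. j \<le> l}" using that by force
    then have "fst (\<Gamma>' l) \<subseteq> fst (\<Gamma>' k)"
      unfolding assms(6) fst_conv by (rule lperp_antimono)
    \<comment> \<open>Here the separating object is \<open>M l\<close>, at the larger index.\<close>
    then show ?thesis using T'[OF that] nT'[of l] by blast
  qed
  then have "nested_family A \<Gamma>'"
    using torsion_pair_gen_torsfree[OF le] by (simp add: nested_family_def assms(6))
  \<comment> \<open>The families differ at every index \<open>k\<close>: \<open>M k\<close> is
    torsion for \<open>\<Gamma> k\<close> but not for \<open>\<Gamma>' k\<close>. An index exists
    because types are nonempty.\<close>
  moreover have "\<Gamma> \<noteq> \<Gamma>'" using T nT' by metis
  moreover have "M \<in> MM_star A \<Gamma>"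
    using assms(2,3) T F nT by (auto simp: MM_star_def MM_def)
  moreover have "M \<in> NN_star A \<Gamma>'"
    using assms(2,3) F' T' nF' by (auto simp: NN_star_def NN_def)
  ultimately show ?thesis using assms(5,6) by (simp add: T_induces_def F_induces_def)
qed

end
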